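(* Let $(X,\mu)$ be a Bourbaki-complete uniform space. Then there exist an index set $I$, cardinals $\kappa_n^i$ ($i\in I$, $n\in\mathbb N$), a cardinal $\alpha\geq\omega_0$ and a (topological) embedding $$\varphi:(X,\mu)\rightarrow\Big(\big(\prod_{i\in I,\,n\in\mathbb N}\kappa_n^i\big)\times\mathbb R^{\alpha},\pi\Big),$$ where each $\kappa_n^i$ is endowed with the uniformly discrete metric $\chi$, such that $\varphi$ is uniformly continuous and $\varphi(X)$ is a closed subspace of $\big(\prod_{i\in I,\,n\in\mathbb N}\kappa_n^i\big)\times\mathbb R^{\alpha}$. Moreover, $$\wp(X,\mu)\leq\sup\Big\{\prod_{j=1}^n\kappa_j^i : n\in\mathbb N,\ i\in I\Big\}.$$
   Context: Uniform spaces are Hausdorff and given by covers: $\mu$ is a family of covers of $X$ (the uniform covers), containing every cover refined by a member of $\mu$, and such that any two members of $\mu$ have a common star-refinement in $\mu$. For a cover $\mathcal U$ of $X$ and $A\subset X$: $St(A,\mathcal U)=\bigcup\{U\in\mathcal U: U\cap A\neq\emptyset\}$, $St^0(A,\mathcal U)=A$, $St^m(A,\mathcal U)=St(St^{m-1}(A,\mathcal U),\mathcal U)$ for $m\geq 1$. A filter $\mathcal F$ on $X$ is Bourbaki-Cauchy if for every $\mathcal U\in\mu$ there are $m\in\mathbb N$, $U\in\mathcal U$ and $F\in\mathcal F$ with $F\subset St^m(U,\mathcal U)$. $(X,\mu)$ is Bourbaki-complete if every Bourbaki-Cauchy filter has a cluster point. The uniformly discrete metric on a set is $\chi(d,e)=0$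 if $d=e$ and $\chi(d,e)=1$ otherwise. $\mathbb R$ carries the Euclidean metric, and $\pi$ denotes the product uniformity. A topological embedding is a homeomorphism onto its image. A uniform partition of $(X,\mu)$ is a partition $\mathcal P$ of $X$ with $\mathcal P\in\mu$ (equivalently, refined by some $\mathcal U\in\mu$). $\wp(X,\mu)=\sup\{|\mathcal P|:\mathcal P\text{ is a uniform partition of }(X,\mu)\}$. *)

theory Defs
  imports "HOL-Analysis.Analysis"
begin

unbundle cardinal_syntax

section \<open>Uniform spaces given by covers\<close>

definition cover_of :: "'a set \<Rightarrow> 'a set set \<Rightarrow> bool" where
  "cover_of X U \<longleftrightarrow> \<Union>U = X"

text \<open>In \<open>refined_by V U\<close> and \<open>star_refined_by V U\<close> the finer cover is \<open>U\<close>.\<close>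

definition refined_by :: "'a set set \<Rightarrow> 'a set set \<Rightarrow> bool" where
  "refined_by V U \<longleftrightarrow> (\<forall>A\<in>U. \<exists>B\<in>V. A \<subseteq> B)"

definition star :: "'a set \<Rightarrow> 'a set set \<Rightarrow> 'a set" where
  "star A U = \<Union>{B \<in> U. B \<inter> A \<noteq> {}}"

primrec star_iter :: "nat \<Rightarrow> 'a set \<Rightarrow> 'a set set \<Rightarrow> 'a set" where
  "star_iter 0 A U = A"
| "star_iter (Suc m) A U = star (star_iter m A U) U"

definition star_refined_by :: "'a set set \<Rightarrow> 'a set set \<Rightarrow> bool" where
  "star_refined_by V U \<longleftrightarrow> (\<forall>A\<in>U. \<exists>B\<in>V. star A U \<subseteq> B)"

definition cover_uniformity :: "'a set \<Rightarrow> 'a set set set \<Rightarrow> bool" where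
  "cover_uniformity X \<mu> \<longleftrightarrow>
     \<mu> \<noteq> {} \<and>
     (\<forall>U\<in>\<mu>. cover_of X U) \<and>
     (\<forall>U\<in>\<mu>. \<forall>V. cover_of X V \<and> refined_by V U \<longrightarrow> V \<in> \<mu>) \<and>
     (\<forall>U\<in>\<mu>. \<forall>V\<in>\<mu>. \<exists>W\<in>\<mu>. star_refined_by U W \<and> star_refined_by V W)"

text \<open>
  The condition \<open>\<mu> \<noteq> {}\<close> makes the family \<open>\<lambda>G. ...\<close> below a topology on \<open>X\<close>.
\<close>

definition unif_topology :: "'a set \<Rightarrow> 'a set set set \<Rightarrow> 'a topology" where
  "unif_topology X \<mu> =
     topology (\<lambda>G. G \<subseteq> X \<and> (\<forall>x\<in>G. \<exists>U\<in>\<mu>. star {x} U \<subseteq> G))"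

definition unif_continuous ::
  "'a set \<Rightarrow> 'a set set set \<Rightarrow> 'b set \<Rightarrow> 'b set set set \<Rightarrow> ('a \<Rightarrow> 'b) \<Rightarrow> bool" where
  "unif_continuous X \<mu> Y \<nu> f \<longleftrightarrow>
     f ` X \<subseteq> Y \<and> (\<forall>V\<in>\<nu>. (\<lambda>B. f -` B \<inter> X) ` V \<in> \<mu>)"

text \<open>
  A (proper) filter on \<open>X\<close> is a library filter \<open>F\<close> with \<open>F \<noteq> bot\<close> that contains \<open>X\<close>, i.e.
  \<open>F \<le> principal X\<close>; the statement \<open>S \<in> F\<close> reads \<open>\<forall>\<^sub>F x in F. x \<in> S\<close>, and
  \<open>\<exists>\<^sub>F x in F. x \<in> G\<close> says that \<open>G\<close> meets every member of \<open>F\<close>.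
\<close>

definition Bourbaki_Cauchy :: "'a set set set \<Rightarrow> 'a filter \<Rightarrow> bool" where
  "Bourbaki_Cauchy \<mu> F \<longleftrightarrow>
     (\<forall>U\<in>\<mu>. \<exists>m. \<exists>A\<in>U. \<forall>\<^sub>F x in F. x \<in> star_iter m A U)"

definition cluster_point :: "'a topology \<Rightarrow> 'a filter \<Rightarrow> 'a \<Rightarrow> bool" where
  "cluster_point T F x \<longleftrightarrow>
     x \<in> topspace T \<and> (\<forall>G. openin T G \<and> x \<in> G \<longrightarrow> (\<exists>\<^sub>F y in F. y \<in> G))"

definition Bourbaki_complete :: "'a set \<Rightarrow> 'a set set set \<Rightarrow> bool" where
  "Bourbaki_complete X \<mu> \<longleftrightarrow>
     (\<forall>F. F \<noteq> bot \<and> F \<le> principal X \<and> Bourbaki_Cauchy \<mu> F \<longrightarrow>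
        (\<exists>x. cluster_point (unif_topology X \<mu>) F x))"

definition uniform_partition :: "'a set \<Rightarrow> 'a set set set \<Rightarrow> 'a set set \<Rightarrow> bool" where
  "uniform_partition X \<mu> P \<longleftrightarrow> partition_on X P \<and> P \<in> \<mu>"


section \<open>Metric and product uniformities\<close>

definition metric_uniformity :: "'a metric \<Rightarrow> 'a set set set" where
  "metric_uniformity m =
     {V. cover_of (mspace m) V \<and> (\<exists>e>0. refined_by V {mball_of m x e | x. x \<in> mspace m})}"

definition discrete_metric_on :: "'a set \<Rightarrow> 'a metric" where
  "discrete_metric_on D = metric (D, discrete_metric.dd)"

definition prod_uniformity ::
  "'j set \<Rightarrow> ('j \<Rightarrow> 'b set) \<Rightarrow> ('j \<Rightarrow> 'b set set set) \<Rightarrow> ('j \<Rightarrow> 'b) set set set" where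
  "prod_uniformity J Y \<nu> =
     {V. cover_of (PiE J Y) V \<and>
         (\<exists>K U. finite K \<and> K \<subseteq> J \<and> (\<forall>k\<in>K. U k \<in> \<nu> k) \<and>
            refined_by V {{f \<in> PiE J Y. \<forall>k\<in>K. f k \<in> B k} | B. \<forall>k\<in>K. B k \<in> U k})}"

definition pair_uniformity ::
  "'a set \<Rightarrow> 'a set set set \<Rightarrow> 'b set \<Rightarrow> 'b set set set \<Rightarrow> ('a \<times> 'b) set set set" where
  "pair_uniformity X \<mu> Y \<nu> =
     {V. cover_of (X \<times> Y) V \<and>
         (\<exists>U\<in>\<mu>. \<exists>W\<in>\<nu>. refined_by V {A \<times> B | A B. A \<in> U \<and> B \<in> W})}"


section \<open>Suprema of cardinals\<close>

text \<open>
  Cardinals are the cardinal orders of the library; a cardinal \<open>r\<close>, viewed as a set, is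
  \<open>Field r\<close>. An upper bound living on another type that is smaller than some cardinal on \<open>'b\<close>
  has a copy on \<open>'b\<close>, so comparing upper bounds within \<open>'b\<close> gives the true supremum.
\<close>

definition is_card_sup :: "'b rel set \<Rightarrow> 'b rel \<Rightarrow> bool" where
  "is_card_sup R s \<longleftrightarrow>
     Card_order s \<and> (\<forall>r\<in>R. r \<le>o s) \<and>
     (\<forall>t :: 'b rel. Card_order t \<and> (\<forall>r\<in>R. r \<le>o t) \<longrightarrow> s \<le>o t)"

definition card_sup :: "'b rel set \<Rightarrow> 'b rel" where
  "card_sup R = (SOME s. is_card_sup R s)"

definition partition_number :: "'a set \<Rightarrow> 'a set set set \<Rightarrow> 'a set rel" where
  "partition_number X \<mu> = card_sup {|P| | P. uniform_partition X \<mu> P}"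


section \<open>The target space\<close>

text \<open>
  The space \<open>(\<Prod>i\<in>I. \<Prod>n\<ge>1. \<kappa> i n) \<times> \<real>\<^sup>\<alpha>\<close>, with \<open>n\<close> ranging over the positive
  integers. HOL has no existential quantifier over types, so an assertion that \<open>I\<close>, \<open>\<kappa>\<close>, \<open>\<alpha>\<close>
  exist has to name types for them in terms of the type \<open>'a\<close> of points. A witness on particular
  types is a witness outright, so this only sharpens the assertion.
\<close>

definition target_space ::
  "'i set \<Rightarrow> ('i \<Rightarrow> nat \<Rightarrow> 'k rel) \<Rightarrow> 'r rel \<Rightarrow> (('i \<times> nat \<Rightarrow> 'k) \<times> ('r \<Rightarrow> real)) set" where
  "target_space I \<kappa> \<alpha> =
     (\<Pi>\<^sub>E (i, n) \<in> I \<times> {1..}. Field (\<kappa> i n)) \<times> (\<Pi>\<^sub>E a \<in> Field \<alpha>. UNIV)"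

definition target_uniformity ::
  "'i set \<Rightarrow> ('i \<Rightarrow> nat \<Rightarrow> 'k rel) \<Rightarrow> 'r rel \<Rightarrow>
     (('i \<times> nat \<Rightarrow> 'k) \<times> ('r \<Rightarrow> real)) set set set" where
  "target_uniformity I \<kappa> \<alpha> =
     pair_uniformity
       (\<Pi>\<^sub>E (i, n) \<in> I \<times> {1..}. Field (\<kappa> i n))
       (prod_uniformity (I \<times> {1..}) (\<lambda>(i, n). Field (\<kappa> i n))
          (\<lambda>(i, n). metric_uniformity (discrete_metric_on (Field (\<kappa> i n)))))
       (\<Pi>\<^sub>E a \<in> Field \<alpha>. UNIV)
       (prod_uniformity (Field \<alpha>) (\<lambda>a. UNIV) (\<lambda>a. metric_uniformity euclidean_metric))"


section \<open>The notions are well defined\<close>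

lemma star_mono: "A \<subseteq> B \<Longrightarrow> star A U \<subseteq> star B U"
  unfolding star_def by blast

lemma star_refined_byD: "star_refined_by V U \<Longrightarrow> refined_by V U"
  unfolding star_refined_by_def refined_by_def
proof (intro ballI)
  fix A assume *: "\<forall>A\<in>U. \<exists>B\<in>V. star A U \<subseteq> B" "A \<in> U"
  then obtain B where "B \<in> V" "star A U \<subseteq> B" by blast
  moreover have "A \<subseteq> star A U" using * by (auto simp: star_def)
  ultimately show "\<exists>B\<in>V. A \<subseteq> B" by blast
qed

lemma star_refine_star:
  assumes "star_refined_by V W" "y \<in> star {x} W"
  shows "star {y} W \<subseteq> star {x} V"
proof
  fix z assume "z \<in> star {y} W"
  then obtain A where A: "A \<in> W" "y \<in> A" "z \<in> A" by (auto simp: star_def)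
  obtain A' where A': "A' \<in> W" "x \<in> A'" "y \<in> A'" using assms(2) by (auto simp: star_def)
  obtain B where B: "B \<in> V" "star A' W \<subseteq> B" using assms(1) A' by (auto simp: star_refined_by_def)
  have "A' \<subseteq> star A' W" "A \<subseteq> star A' W" using A A' by (auto simp: star_def)
  then have "x \<in> B" "z \<in> B" using A A' B by auto
  then show "z \<in> star {x} V" using B(1) unfolding star_def by blast
qed

lemma istopology_unif:
  assumes "cover_uniformity X \<mu>"
  shows "istopology (\<lambda>G. G \<subseteq> X \<and> (\<forall>x\<in>G. \<exists>U\<in>\<mu>. star {x} U \<subseteq> G))"
  unfolding istopology_def
proof (rule conjI; intro allI impI)
  fix S T
  assume S: "S \<subseteq> X \<and> (\<forall>x\<in>S. \<exists>U\<in>\<mu>. star {x} U \<subseteq> S)"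
    and T: "T \<subseteq> X \<and> (\<forall>x\<in>T. \<exists>U\<in>\<mu>. star {x} U \<subseteq> T)"
  have "\<exists>W\<in>\<mu>. star {x} W \<subseteq> S \<inter> T" if x: "x \<in> S" "x \<in> T" for x
  proof -
    obtain U V where UV: "U \<in> \<mu>" "star {x} U \<subseteq> S" "V \<in> \<mu>" "star {x} V \<subseteq> T"
      using S T x by blast
    then obtain W where W: "W \<in> \<mu>" "refined_by U W" "refined_by V W"
      using assms star_refined_byD unfolding cover_uniformity_def by blast
    then have "star {x} W \<subseteq> star {x} U" "star {x} W \<subseteq> star {x} V"
      unfolding star_def refined_by_def by fast+
    then show ?thesis using UV W by blast
  qed
  then show "S \<inter> T \<subseteq> X \<and> (\<forall>x\<in>S \<inter> T. \<exists>U\<in>\<mu>. star {x} U \<subseteq> S \<inter> T)"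
    using S by blast
next
  fix K
  assume K: "\<forall>S\<in>K. S \<subseteq> X \<and> (\<forall>x\<in>S. \<exists>U\<in>\<mu>. star {x} U \<subseteq> S)"
  have "\<exists>U\<in>\<mu>. star {x} U \<subseteq> \<Union>K" if "x \<in> S" "S \<in> K" for x S
    using K that by (meson Union_upper order_trans)
  then show "\<Union>K \<subseteq> X \<and> (\<forall>x\<in>\<Union>K. \<exists>U\<in>\<mu>. star {x} U \<subseteq> \<Union>K)"
    using K by blast
qed

lemma openin_unif_topology:
  assumes "cover_uniformity X \<mu>"
  shows "openin (unif_topology X \<mu>) G \<longleftrightarrow> G \<subseteq> X \<and> (\<forall>x\<in>G. \<exists>U\<in>\<mu>. star {x} U \<subseteq> G)"
  unfolding unif_topology_def using topology_inverse'[OF istopology_unif[OF assms]] by simp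

lemma topspace_unif_topology [simp]:
  assumes "cover_uniformity X \<mu>"
  shows "topspace (unif_topology X \<mu>) = X"
proof -
  obtain U where U: "U \<in> \<mu>" "cover_of X U" using assms by (auto simp: cover_uniformity_def)
  then have "star {x} U \<subseteq> X" for x by (auto simp: star_def cover_of_def)
  then have "openin (unif_topology X \<mu>) X" using U openin_unif_topology[OF assms] by blast
  then show ?thesis using openin_unif_topology[OF assms]
    by (metis openin_subset openin_topspace subset_antisym)
qed

lemma mspace_discrete_metric_on [simp]: "mspace (discrete_metric_on D) = D"
  unfolding discrete_metric_on_def
  using Metric_space.mspace_metric[OF metric_M_dd] .

lemma mdist_discrete_metric_on [simp]:
  "mdist (discrete_metric_on D) = (\<lambda>d e. if d = e then 0 else 1)"
  unfolding discrete_metric_on_def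
  using Metric_space.mdist_metric[OF metric_M_dd]
  by (simp add: discrete_metric.dd_def)

lemma refined_by_trans: "refined_by U V \<Longrightarrow> refined_by V W \<Longrightarrow> refined_by U W"
  unfolding refined_by_def by (meson order_trans)

lemma refined_by_refl: "refined_by U U"
  unfolding refined_by_def by blast

lemma cover_uniformity_from_base:
  assumes ne: "\<B> \<noteq> {}" and cov: "\<And>U. U \<in> \<B> \<Longrightarrow> cover_of X U"
    and star: "\<And>U V. U \<in> \<B> \<Longrightarrow> V \<in> \<B> \<Longrightarrow> \<exists>W\<in>\<B>. star_refined_by U W \<and> star_refined_by V W"
  shows "cover_uniformity X {V. cover_of X V \<and> (\<exists>U\<in>\<B>. refined_by V U)}"
  unfolding cover_uniformity_def
proof (intro conjI ballI allI impI)
  show "{V. cover_of X V \<and> (\<exists>U\<in>\<B>. refined_by V U)} \<noteq> {}"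
    using ne cov refined_by_refl by fastforce
next
  fix U V assume "U \<in> {V. cover_of X V \<and> (\<exists>U\<in>\<B>. refined_by V U)}"
    "V \<in> {V. cover_of X V \<and> (\<exists>U\<in>\<B>. refined_by V U)}"
  then obtain U' V' where U': "U' \<in> \<B>" "refined_by U U'" and V': "V' \<in> \<B>" "refined_by V V'"
    by blast
  obtain W where W: "W \<in> \<B>" "star_refined_by U' W" "star_refined_by V' W"
    using star[OF U'(1) V'(1)] by blast
  have "star_refined_by U W" "star_refined_by V W"
    using W(2,3) U'(2) V'(2) unfolding star_refined_by_def refined_by_def
    by (meson order_trans)+
  then show "\<exists>W\<in>{V. cover_of X V \<and> (\<exists>U\<in>\<B>. refined_by V U)}.
      star_refined_by U W \<and> star_refined_by V W"
    using W(1) cov refined_by_refl by blast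
next
  fix U V assume "U \<in> {V. cover_of X V \<and> (\<exists>U\<in>\<B>. refined_by V U)}"
    "cover_of X V \<and> refined_by V U"
  then show "V \<in> {V. cover_of X V \<and> (\<exists>U\<in>\<B>. refined_by V U)}"
    using refined_by_trans by fast
qed simp

lemma cover_uniformity_metric: "cover_uniformity (mspace m) (metric_uniformity m)"
proof -
  interpret Metric_space "mspace m" "mdist m" by (rule Metric_space_mspace_mdist)
  define C where "C e = {mball x e | x. x \<in> mspace m}" for e
  have C: "metric_uniformity m =
      {V. cover_of (mspace m) V \<and> (\<exists>U\<in>C ` {0<..}. refined_by V U)}"
    unfolding metric_uniformity_def C_def mball_of_def by auto
  have cov: "cover_of (mspace m) (C e)" if "e > 0" for e
    using that unfolding cover_of_def C_def by auto
  have half: "star_refined_by (C e) (C d)" if "0 < d" "3 * d \<le> e" for d e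
    unfolding star_refined_by_def
  proof
    fix A assume "A \<in> C d"
    then obtain x where x: "x \<in> mspace m" "A = mball x d" by (auto simp: C_def)
    have "star A (C d) \<subseteq> mball x e"
    proof
      fix z assume "z \<in> star A (C d)"
      then obtain B where B: "B \<in> C d" "B \<inter> A \<noteq> {}" "z \<in> B" unfolding star_def by blast
      then obtain y where y: "B = mball y d" unfolding C_def by blast
      with B x obtain w where "w \<in> mball x d" "w \<in> mball y d" "z \<in> mball y d" by blast
      then have *: "w \<in> mspace m" "z \<in> mspace m" "y \<in> mspace m"
        "mdist m x w < d" "mdist m y w < d" "mdist m y z < d" by auto
      have "mdist m x z \<le> mdist m x w + mdist m w z" "mdist m w z \<le> mdist m w y + mdist m y z"
        using * x triangle by auto
      then have "mdist m x z < e" using * that commute[of w y] by linarith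
      then show "z \<in> mball x e" using * x by auto
    qed
    then show "\<exists>B\<in>C e. star A (C d) \<subseteq> B" using x by (auto simp: C_def)
  qed
  show ?thesis unfolding C
  proof (rule cover_uniformity_from_base)
    fix U V assume "U \<in> C ` {0<..}" "V \<in> C ` {0<..}"
    then obtain a b where ab: "a > 0" "b > 0" "U = C a" "V = C b" by auto
    have "star_refined_by U (C (min a b / 3))" "star_refined_by V (C (min a b / 3))"
      using ab by (auto intro!: half)
    then show "\<exists>W\<in>C ` {0<..}. star_refined_by U W \<and> star_refined_by V W"
      using ab by (intro bexI[of _ "C (min a b / 3)"]) auto
  qed (use cov in auto)
qed

lemma cover_uniformity_pair:
  assumes \<mu>: "cover_uniformity X \<mu>" and \<nu>: "cover_uniformity Y \<nu>"
  shows "cover_uniformity (X \<times> Y) (pair_uniformity X \<mu> Y \<nu>)"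
proof -
  define C where "C U W = {A \<times> B | A B. A \<in> U \<and> B \<in> W}" for U :: "'a set set" and W :: "'b set set"
  have C: "pair_uniformity X \<mu> Y \<nu> =
      {V. cover_of (X \<times> Y) V \<and> (\<exists>U\<in>(\<lambda>(U, W). C U W) ` (\<mu> \<times> \<nu>). refined_by V U)}"
    unfolding pair_uniformity_def C_def by fastforce
  have st: "star_refined_by (C U W) (C U' W')"
    if U: "star_refined_by U U'" and W: "star_refined_by W W'" for U U' W W'
    unfolding star_refined_by_def
  proof
    fix Z assume "Z \<in> C U' W'"
    then obtain A B where Z: "Z = A \<times> B" "A \<in> U'" "B \<in> W'" by (auto simp: C_def)
    obtain A' where A': "A' \<in> U" "star A U' \<subseteq> A'"
      using Z U unfolding star_refined_by_def by blast
    obtain B' where B': "B' \<in> W" "star B W' \<subseteq> B'"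
      using Z W unfolding star_refined_by_def by blast
    have "star Z (C U' W') \<subseteq> A' \<times> B'"
      using A'(2) B'(2) unfolding star_def C_def Z by blast
    then show "\<exists>B\<in>C U W. star Z (C U' W') \<subseteq> B" using A' B' by (auto simp: C_def)
  qed
  show ?thesis unfolding C
  proof (rule cover_uniformity_from_base)
    show "(\<lambda>(U, W). C U W) ` (\<mu> \<times> \<nu>) \<noteq> {}"
      using \<mu> \<nu> by (auto simp: cover_uniformity_def)
    fix S assume "S \<in> (\<lambda>(U, W). C U W) ` (\<mu> \<times> \<nu>)"
    then obtain U W where S: "S = C U W" "U \<in> \<mu>" "W \<in> \<nu>" by auto
    have "\<Union>U = X" "\<Union>W = Y"
      using S \<mu> \<nu> by (simp_all add: cover_uniformity_def cover_of_def)
    moreover have "\<Union>(C U W) = \<Union>U \<times> \<Union>W" unfolding C_def by (auto; blast)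
    ultimately show "cover_of (X \<times> Y) S" using S by (simp add: cover_of_def)
  next
    fix S T assume "S \<in> (\<lambda>(U, W). C U W) ` (\<mu> \<times> \<nu>)" "T \<in> (\<lambda>(U, W). C U W) ` (\<mu> \<times> \<nu>)"
    then obtain U1 W1 U2 W2 where S: "S = C U1 W1" "U1 \<in> \<mu>" "W1 \<in> \<nu>"
      and T: "T = C U2 W2" "U2 \<in> \<mu>" "W2 \<in> \<nu>" by auto
    obtain U3 where U3: "U3 \<in> \<mu>" "star_refined_by U1 U3" "star_refined_by U2 U3"
      using \<mu> S T unfolding cover_uniformity_def by blast
    obtain W3 where W3: "W3 \<in> \<nu>" "star_refined_by W1 W3" "star_refined_by W2 W3"
      using \<nu> S T unfolding cover_uniformity_def by blast
    show "\<exists>W\<in>(\<lambda>(U, W). C U W) ` (\<mu> \<times> \<nu>). star_refined_by S W \<and> star_refined_by T W"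
      using U3 W3 st S T by (intro bexI[of _ "C U3 W3"]) auto
  qed
qed

lemma cover_uniformity_prod:
  assumes \<nu>: "\<And>j. j \<in> J \<Longrightarrow> cover_uniformity (Y j) (\<nu> j)"
  shows "cover_uniformity (PiE J Y) (prod_uniformity J Y \<nu>)"
proof -
  define C where "C K U = {{f \<in> PiE J Y. \<forall>k\<in>K. f k \<in> B k} | B. \<forall>k\<in>K. B k \<in> U k}"
    for K and U :: "'a \<Rightarrow> 'b set set"
  define \<B> where "\<B> = {C K U | K U. finite K \<and> K \<subseteq> J \<and> (\<forall>k\<in>K. U k \<in> \<nu> k)}"
  have C: "prod_uniformity J Y \<nu> =
      {V. cover_of (PiE J Y) V \<and> (\<exists>U\<in>\<B>. refined_by V U)}"
    unfolding prod_uniformity_def \<B>_def C_def by blast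
  have st: "star_refined_by (C K U) (C L W)"
    if KL: "K \<subseteq> L" and UW: "\<And>k. k \<in> K \<Longrightarrow> star_refined_by (U k) (W k)" for K L U W
    unfolding star_refined_by_def
  proof
    fix Z assume "Z \<in> C L W"
    then obtain B where Z: "Z = {f \<in> PiE J Y. \<forall>k\<in>L. f k \<in> B k}" "\<forall>k\<in>L. B k \<in> W k"
      by (auto simp: C_def)
    have "\<forall>k\<in>K. \<exists>A\<in>U k. star (B k) (W k) \<subseteq> A"
      using UW Z KL unfolding star_refined_by_def by blast
    then obtain A where A: "\<forall>k\<in>K. A k \<in> U k \<and> star (B k) (W k) \<subseteq> A k" by metis
    have "star Z (C L W) \<subseteq> {f \<in> PiE J Y. \<forall>k\<in>K. f k \<in> A k}"
    proof
      fix f assume "f \<in> star Z (C L W)"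
      then obtain D where D: "\<forall>k\<in>L. D k \<in> W k" "f \<in> PiE J Y" "\<forall>k\<in>L. f k \<in> D k"
        "{f \<in> PiE J Y. \<forall>k\<in>L. f k \<in> D k} \<inter> Z \<noteq> {}"
        by (auto simp: star_def C_def)
      then obtain g where "\<forall>k\<in>L. g k \<in> D k \<and> g k \<in> B k" using Z by blast
      then have "f k \<in> star (B k) (W k)" if "k \<in> K" for k
        using that KL D unfolding star_def by blast
      then show "f \<in> {f \<in> PiE J Y. \<forall>k\<in>K. f k \<in> A k}" using A D by blast
    qed
    moreover have "{f \<in> PiE J Y. \<forall>k\<in>K. f k \<in> A k} \<in> C K U" using A unfolding C_def by blast
    ultimately show "\<exists>B\<in>C K U. star Z (C L W) \<subseteq> B" by blast
  qed
  show ?thesis unfolding C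
  proof (rule cover_uniformity_from_base)
    show "\<B> \<noteq> {}" unfolding \<B>_def by blast
    fix S assume "S \<in> \<B>"
    then obtain K U where S: "S = C K U" "finite K" "K \<subseteq> J" "\<forall>k\<in>K. U k \<in> \<nu> k"
      by (auto simp: \<B>_def)
    have UY: "\<Union>(U k) = Y k" if "k \<in> K" for k
      using S that \<nu> unfolding cover_uniformity_def cover_of_def by blast
    show "cover_of (PiE J Y) S" unfolding cover_of_def
    proof
      show "\<Union>S \<subseteq> PiE J Y" unfolding S C_def by blast
      show "PiE J Y \<subseteq> \<Union>S"
      proof
        fix f assume f: "f \<in> PiE J Y"
        then have "\<forall>k\<in>K. \<exists>B\<in>U k. f k \<in> B" using UY S by (metis PiE_mem Union_iff subsetD)
        then obtain B where "\<forall>k\<in>K. B k \<in> U k \<and> f k \<in> B k" by metis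
        then show "f \<in> \<Union>S" using f unfolding S C_def by blast
      qed
    qed
  next
    fix S T assume "S \<in> \<B>" "T \<in> \<B>"
    then obtain K1 U1 K2 U2 where S: "S = C K1 U1" "finite K1" "K1 \<subseteq> J" "\<forall>k\<in>K1. U1 k \<in> \<nu> k"
      and T: "T = C K2 U2" "finite K2" "K2 \<subseteq> J" "\<forall>k\<in>K2. U2 k \<in> \<nu> k"
      by (auto simp: \<B>_def)
    have "\<exists>W. k \<in> K1 \<union> K2 \<longrightarrow> W \<in> \<nu> k \<and> (k \<in> K1 \<longrightarrow> star_refined_by (U1 k) W) \<and>
        (k \<in> K2 \<longrightarrow> star_refined_by (U2 k) W)" for k
      using S T \<nu>[of k] unfolding cover_uniformity_def by (metis Un_iff subsetD)
    then obtain W where W: "\<And>k. k \<in> K1 \<union> K2 \<Longrightarrow> W k \<in> \<nu> k \<and>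
        (k \<in> K1 \<longrightarrow> star_refined_by (U1 k) (W k)) \<and>
        (k \<in> K2 \<longrightarrow> star_refined_by (U2 k) (W k))" by metis
    have "C (K1 \<union> K2) W \<in> \<B>" unfolding \<B>_def using W S T by blast
    moreover have "star_refined_by S (C (K1 \<union> K2) W)" "star_refined_by T (C (K1 \<union> K2) W)"
      unfolding S T using W by (auto intro!: st)
    ultimately show "\<exists>W\<in>\<B>. star_refined_by S W \<and> star_refined_by T W" by blast
  qed
qed

lemma cover_uniformity_target:
  "cover_uniformity (target_space I \<kappa> \<alpha>) (target_uniformity I \<kappa> \<alpha>)"
  unfolding target_space_def target_uniformity_def
proof (intro cover_uniformity_pair cover_uniformity_prod)
  show "cover_uniformity (case j of (i, n) \<Rightarrow> Field (\<kappa> i n))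
      (case j of (i, n) \<Rightarrow> metric_uniformity (discrete_metric_on (Field (\<kappa> i n))))" for j
    using cover_uniformity_metric[of "discrete_metric_on _"] by (simp add: case_prod_beta)
  show "cover_uniformity UNIV (metric_uniformity euclidean_metric)"
    using cover_uniformity_metric[of euclidean_metric] by simp
qed

lemma is_card_sup_card_sup:
  fixes R :: "'b rel set"
  assumes "\<And>r. r \<in> R \<Longrightarrow> Card_order r"
  shows "is_card_sup R (card_sup R)"
proof -
  let ?S = "{t :: 'b rel. Card_order t \<and> (\<forall>r\<in>R. r \<le>o t)}"
  have "r \<le>o |UNIV :: 'b set|" if "r \<in> R" for r
    using assms[OF that] card_of_Field_ordIso card_of_mono1[of "Field r" UNIV]
    by (metis ordIso_ordLeq_trans ordIso_symmetric subset_UNIV)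
  then have "|UNIV :: 'b set| \<in> ?S" by (simp add: card_of_Card_order)
  then obtain s where "s \<in> ?S" "\<forall>t\<in>?S. s \<le>o t"
    using exists_minim_Card_order[of ?S] by blast
  then have "is_card_sup R s" unfolding is_card_sup_def by blast
  then show ?thesis unfolding card_sup_def by (rule someI)
qed

end

theory Submission
  imports Defs
begin

text \<open>
  The embedding collects two kinds of uniformly continuous maps on \<open>X\<close>: for every uniform partition
  \<open>P\<close> the map to the discrete space \<open>P\<close> that sends a point to its cell, and all uniformly continuous
  real functions. So \<open>I\<close> is the set of uniform partitions and \<open>\<kappa> P n = |P|\<close>, which makes the bound on
  the partition number immediate, up to the comparison of suprema on different types
  (\<open>card_sup_ordLeq\<close>). Uniform continuity holds coordinatewise.

  The real coordinates give an embedding. By the metrization lemma each uniform cover \<open>U\<close> has a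
  uniformly continuous pseudometric \<open>d\<close> with points at distance less than one sharing a member of
  \<open>U\<close> (\<open>uniform_pseudometric\<close>), and the functions \<open>d x\<close> separate a point \<open>x\<close> from the complement
  of a neighbourhood.

  Bourbaki-completeness makes the image closed. Call two points equivalent if a finite chain of
  members of \<open>U\<close> connects them; the classes form a uniform partition. On each class count the links of
  a shortest chain from a base point. This integer-valued function changes by at most one within a
  member of \<open>U\<close>, and it is at bounded distance from a uniformly continuous real function \<open>\<rho>\<close>
  (\<open>uniform_smoothing\<close>, \<open>coarse_distance\<close>). If the image of a filter converges in the target space,
  then the filter lives on one class and \<open>\<rho>\<close> is bounded along it, so the filter contains a finite
  iterated star of a member of \<open>U\<close>. As \<open>U\<close> is arbitrary, the filter is Bourbaki-Cauchy
  (\<open>Bourbaki_Cauchy_if_coordinates_converge\<close>). Its cluster point is mapped to the limit, because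
  the target space is Hausdorff (\<open>closedin_image_if_cluster_points\<close>).
\<close>

section \<open>Pseudometrics from normal sequences of covers\<close>

text \<open>
  A pseudometric on the whole type: distinct points may have distance zero. Its values outside the
  carrier of a uniform space do not matter.
\<close>

definition pseudometric :: "('a \<Rightarrow> 'a \<Rightarrow> real) \<Rightarrow> bool" where
  "pseudometric d \<longleftrightarrow> (\<forall>x y. 0 \<le> d x y) \<and> (\<forall>x. d x x = 0) \<and> (\<forall>x y. d x y = d y x) \<and>
     (\<forall>x y z. d x z \<le> d x y + d y z)"

lemma pseudometric_nonneg: "pseudometric d \<Longrightarrow> 0 \<le> d x y"
  and pseudometric_refl: "pseudometric d \<Longrightarrow> d x x = 0"
  and pseudometric_sym: "pseudometric d \<Longrightarrow> d x y = d y x"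
  and pseudometric_triangle: "pseudometric d \<Longrightarrow> d x z \<le> d x y + d y z"
  unfolding pseudometric_def by simp_all

text \<open>
  The estimate behind the metrization lemma: if \<open>f\<close> satisfies the weak four-point inequality
  \<open>quasi\<close>, then \<open>f\<close> is at most twice the length of any chain. A chain is cut at the link which
  contains its midpoint, so that the two remaining pieces have at most half of its length.
\<close>

lemma chain_sum_bound:
  fixes f :: "'a \<Rightarrow> 'a \<Rightarrow> real" and x :: "nat \<Rightarrow> 'a"
  assumes nonneg: "\<And>a b. 0 \<le> f a b" and refl: "\<And>a. f a a = 0"
    and quasi: "\<And>a b c d e. f a b \<le> e \<Longrightarrow> f b c \<le> e \<Longrightarrow> f c d \<le> e \<Longrightarrow> f a d \<le> 2 * e"
    and "i \<le> j"
  shows "f (x i) (x j) \<le> 2 * (\<Sum>k=i..<j. f (x k) (x (Suc k)))"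
  using \<open>i \<le> j\<close>
proof (induction "j - i" arbitrary: i j rule: less_induct)
  case less
  define s where "s i j = (\<Sum>k=i..<j. f (x k) (x (Suc k)))" for i j
  have s0: "0 \<le> s i j" for i j
    unfolding s_def by (intro sum_nonneg nonneg)
  have IH: "f (x k) (x l) \<le> 2 * s k l" if "l - k < j - i" "k \<le> l" for k l
    using less(1)[of l k] that unfolding s_def by blast
  have "f (x i) (x j) \<le> 2 * s i j"
  proof (cases "i = j")
    case True
    then show ?thesis using refl s0 by simp
  next
    case False
    then have ij: "i < j" using less.prems by simp
    define K where "K = {k. i \<le> k \<and> k < j \<and> s i k \<le> s i j / 2}"
    have "finite K" "i \<in> K" using s0[of i j] ij by (auto simp: K_def s_def)
    define k where "k = Max K"
    have kK: "k \<in> K" and kmax: "\<And>l. l \<in> K \<Longrightarrow> l \<le> k"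
      unfolding k_def using \<open>finite K\<close> \<open>i \<in> K\<close> by (auto intro: Max_in)
    have k: "i \<le> k" "k < j" "s i k \<le> s i j / 2" using kK by (auto simp: K_def)
    have right: "s (Suc k) j \<le> s i j / 2"
    proof (cases "Suc k = j")
      case True
      then show ?thesis using s0[of i j] by (simp add: s_def)
    next
      case False
      then have "Suc k < j" using k by simp
      moreover have "Suc k \<notin> K" using kmax[of "Suc k"] by auto
      ultimately have "s i (Suc k) > s i j / 2" using k by (auto simp: K_def)
      moreover have "s i (Suc k) + s (Suc k) j = s i j"
        unfolding s_def using k by (intro sum.atLeastLessThan_concat) auto
      ultimately show ?thesis by linarith
    qed
    have "f (x k) (x (Suc k)) \<le> s i j"
      unfolding s_def using k nonneg by (intro member_le_sum) auto
    moreover have "f (x i) (x k) \<le> s i j" using IH[of k i] k by (simp add: diff_less_mono)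
    moreover have "f (x (Suc k)) (x j) \<le> s i j"
      using IH[of j "Suc k"] k right by (simp add: diff_less_mono2)
    ultimately show ?thesis using quasi by blast
  qed
  then show ?case by (simp add: s_def)
qed

text \<open>
  The largest pseudometric below a symmetric \<open>f\<close> is the infimum of the lengths of chains.
\<close>

lemma chain_pseudometric:
  fixes f :: "'a \<Rightarrow> 'a \<Rightarrow> real"
  assumes nonneg: "\<And>a b. 0 \<le> f a b" and refl: "\<And>a. f a a = 0"
    and sym: "\<And>a b. f a b = f b a"
    and quasi: "\<And>a b c d e. f a b \<le> e \<Longrightarrow> f b c \<le> e \<Longrightarrow> f c d \<le> e \<Longrightarrow> f a d \<le> 2 * e"
  shows "\<exists>d. pseudometric d \<and> (\<forall>x y. d x y \<le> f x y \<and> f x y \<le> 2 * d x y)"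
proof -
  define S where "S a b = {(\<Sum>k=0..<n. f (x k) (x (Suc k))) | x n. x 0 = a \<and> x n = b}" for a b
  define d where "d a b = Inf (S a b)" for a b
  have S_nonneg: "0 \<le> s" if "s \<in> S a b" for s a b
    using that unfolding S_def by (auto intro: sum_nonneg nonneg)
  then have bdd: "bdd_below (S a b)" for a b by (meson bdd_belowI)
  have f_in: "f a b \<in> S a b" for a b
    unfolding S_def
    by (rule CollectI, rule exI[of _ "\<lambda>k. if k = 0 then a else b"], rule exI[of _ 1]) simp
  have S_ne: "S a b \<noteq> {}" for a b using f_in by blast
  have lower: "d a b \<le> s" if "s \<in> S a b" for s a b
    unfolding d_def using that bdd by (rule cInf_lower)
  have greatest: "t \<le> d a b" if "\<And>s. s \<in> S a b \<Longrightarrow> t \<le> s" for t a b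
    unfolding d_def using S_ne that by (rule cInf_greatest)
  have S_concat: "s + t \<in> S a c" if st: "s \<in> S a b" "t \<in> S b c" for s t a b c
  proof -
    obtain x n y m where x: "s = (\<Sum>k=0..<n. f (x k) (x (Suc k)))" "x 0 = a" "x n = b"
      and y: "t = (\<Sum>k=0..<m. f (y k) (y (Suc k)))" "y 0 = b" "y m = c"
      using st unfolding S_def by blast
    define z where "z k = (if k < n then x k else y (k - n))" for k
    have "(\<Sum>k=0..<n + m. f (z k) (z (Suc k))) =
        (\<Sum>k=0..<n. f (z k) (z (Suc k))) + (\<Sum>k=n..<n + m. f (z k) (z (Suc k)))"
      by (rule sum.atLeastLessThan_concat[symmetric]) auto
    also have "(\<Sum>k=0..<n. f (z k) (z (Suc k))) = s"
    proof -
      have "z (Suc k) = x (Suc k)" if "k < n" for k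
        using that x y unfolding z_def by (cases "Suc k = n") auto
      then show ?thesis unfolding x(1) by (intro sum.cong) (auto simp: z_def)
    qed
    also have "(\<Sum>k=n..<n + m. f (z k) (z (Suc k))) = t"
      using sum.shift_bounds_nat_ivl[of "\<lambda>k. f (z k) (z (Suc k))" 0 n m]
      unfolding y(1) by (simp add: z_def add.commute)
    finally have "(\<Sum>k=0..<n + m. f (z k) (z (Suc k))) = s + t" .
    moreover have "z 0 = a" "z (n + m) = c" using x y by (auto simp: z_def)
    ultimately show ?thesis unfolding S_def by force
  qed
  have S_sym: "s \<in> S b a" if s: "s \<in> S a b" for s a b
  proof -
    obtain x n where x: "s = (\<Sum>k=0..<n. f (x k) (x (Suc k)))" "x 0 = a" "x n = b"
      using s unfolding S_def by blast
    have "(\<Sum>k=0..<n. f (x (n - k)) (x (n - Suc k))) = (\<Sum>k=0..<n. f (x k) (x (Suc k)))"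
      by (rule sum.reindex_bij_witness[of _ "\<lambda>k. n - Suc k" "\<lambda>k. n - Suc k"])
        (auto simp: sym Suc_diff_Suc)
    then show ?thesis using x unfolding S_def
      by (intro CollectI exI[of _ "\<lambda>k. x (n - k)"] exI[of _ n]) simp
  qed
  have "pseudometric d"
    unfolding pseudometric_def
  proof (intro conjI allI)
    show "0 \<le> d x y" for x y using greatest S_nonneg by blast
    show "d x x = 0" for x
      using lower[OF f_in, of x x] refl[of x] greatest[of x x 0] S_nonneg by force
    show "d x y = d y x" for x y
    proof -
      have "S x y = S y x" using S_sym by blast
      then show ?thesis by (simp add: d_def)
    qed
    show "d x z \<le> d x y + d y z" for x y z
    proof -
      have "d x z - t \<le> d x y" if "t \<in> S y z" for t
        using lower[OF S_concat[OF _ that]] by (intro greatest) (simp add: algebra_simps)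
      then have "d x z - d x y \<le> d y z" by (intro greatest) (simp add: algebra_simps)
      then show ?thesis by simp
    qed
  qed
  moreover have "d x y \<le> f x y" for x y using lower f_in by blast
  moreover have "f x y \<le> 2 * d x y" for x y
  proof -
    have "f (x 0) (x n) \<le> 2 * (\<Sum>k=0..<n. f (x k) (x (Suc k)))" for x n
      by (rule chain_sum_bound[of f]) (fact nonneg refl quasi | simp)+
    then have "f x y \<le> 2 * s" if "s \<in> S x y" for s
      using that unfolding S_def by blast
    then have "f x y / 2 \<le> d x y" by (intro greatest) (simp add: field_simps)
    then show ?thesis by (simp add: field_simps)
  qed
  ultimately show ?thesis by blast
qed

text \<open>
  The metrization lemma for a sequence of entourages with \<open>E (n + 1) \<circ> E (n + 1) \<circ> E (n + 1) \<subseteq> E n\<close>.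
\<close>

lemma pseudometric_from_entourages:
  fixes E :: "nat \<Rightarrow> ('a \<times> 'a) set"
  assumes refl: "\<And>n x. (x, x) \<in> E n" and sym: "\<And>n. sym (E n)"
    and comp: "\<And>n w x y z. (w, x) \<in> E (Suc n) \<Longrightarrow> (x, y) \<in> E (Suc n) \<Longrightarrow>
      (y, z) \<in> E (Suc n) \<Longrightarrow> (w, z) \<in> E n"
  shows "\<exists>d. pseudometric d \<and> (\<forall>x y. d x y < 1 \<longrightarrow> (x, y) \<in> E 0) \<and>
    (\<forall>n x y. (x, y) \<in> E n \<longrightarrow> d x y \<le> (1/2)^n)"
proof -
  \<comment> \<open>The exponent is the index of the first entourage that misses the pair.\<close>
  define f :: "'a \<Rightarrow> 'a \<Rightarrow> real" where
    "f x y = (if \<forall>n. (x, y) \<in> E n then 0 else (1/2) ^ (LEAST n. (x, y) \<notin> E n))" for x y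
  have dec: "E n \<subseteq> E m" if "m \<le> n" for m n
    using that by (rule lift_Suc_antimono_le[rotated]) (use comp refl in fast)
  have f_ge: "(1/2) ^ n \<le> f x y" if "(x, y) \<notin> E n" for x y n
  proof -
    have "(LEAST n. (x, y) \<notin> E n) \<le> n" using that by (rule Least_le)
    then show ?thesis using that unfolding f_def by (auto intro: power_decreasing)
  qed
  have f_le: "f x y \<le> (1/2) ^ Suc n" if "(x, y) \<in> E n" for x y n
  proof (cases "\<forall>n. (x, y) \<in> E n")
    case False
    then have "(x, y) \<notin> E (LEAST n. (x, y) \<notin> E n)" by (metis (mono_tags, lifting) LeastI)
    then have "Suc n \<le> (LEAST n. (x, y) \<notin> E n)" using dec that by (meson not_less_eq_eq subsetD)
    then show ?thesis unfolding f_def using False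
      by (simp only: if_False) (rule power_decreasing, auto)
  qed (simp add: f_def)
  have f_nonneg: "0 \<le> f x y" for x y unfolding f_def by simp
  have f_refl: "f x x = 0" for x unfolding f_def using refl by simp
  have f_sym: "f x y = f y x" for x y
  proof -
    have "(x, y) \<in> E n \<longleftrightarrow> (y, x) \<in> E n" for n using sym by (meson symE)
    then show ?thesis unfolding f_def by simp
  qed
  have quasi: "f a d \<le> 2 * e" if e: "f a b \<le> e" "f b c \<le> e" "f c d \<le> e" for a b c d e
  proof (cases "\<forall>n. (a, d) \<in> E n")
    case True
    then show ?thesis using e f_nonneg[of a b] by (simp add: f_def)
  next
    case False
    define m where "m = (LEAST n. (a, d) \<notin> E n)"
    have "(a, d) \<notin> E m" unfolding m_def using False by (metis (mono_tags, lifting) LeastI)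
    then have "(a, b) \<notin> E (Suc m) \<or> (b, c) \<notin> E (Suc m) \<or> (c, d) \<notin> E (Suc m)"
      using comp by blast
    then have "(1/2) ^ Suc m \<le> e" using f_ge e by (meson order_trans)
    moreover have "f a d = (1/2) ^ m" using False by (simp add: f_def m_def)
    ultimately show ?thesis by simp
  qed
  have "\<exists>d. pseudometric d \<and> (\<forall>x y. d x y \<le> f x y \<and> f x y \<le> 2 * d x y)"
    by (rule chain_pseudometric) (fact f_nonneg f_refl f_sym quasi)+
  then obtain d where d: "pseudometric d" "\<And>x y. d x y \<le> f x y" "\<And>x y. f x y \<le> 2 * d x y"
    by blast
  \<comment> \<open>Outside \<open>E 0\<close> one has \<open>f = 1\<close>, so \<open>d \<ge> 1/2\<close>; hence the factor two.\<close>
  show ?thesis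
  proof (intro exI[of _ "\<lambda>x y. 2 * d x y"] conjI allI impI)
    show "pseudometric (\<lambda>x y. 2 * d x y)"
      unfolding pseudometric_def
    proof (intro conjI allI)
      show "2 * d x z \<le> 2 * d x y + 2 * d y z" for x y z
        using pseudometric_triangle[OF d(1), of x z y] by simp
    qed (use d(1) in \<open>simp_all add: pseudometric_nonneg pseudometric_refl pseudometric_sym\<close>)
    show "(x, y) \<in> E 0" if "2 * d x y < 1" for x y
      using f_ge[of x y 0] d(3)[of x y] that by fastforce
    show "2 * d x y \<le> (1/2)^n" if "(x, y) \<in> E n" for n x y
      using f_le[OF that] d(2)[of x y] by simp
  qed
qed

text \<open>The pairs of points that share a member of \<open>U\<close>: the entourage of the cover \<open>U\<close>.\<close>

definition entourage :: "'a set set \<Rightarrow> ('a \<times> 'a) set" where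
  "entourage U = {(x, y). \<exists>A\<in>U. x \<in> A \<and> y \<in> A}"

lemma sym_entourage: "sym (entourage U)"
  unfolding entourage_def sym_def by blast

lemma entourage_comp:
  assumes "star_refined_by V W"
    "(w, x) \<in> entourage W" "(x, y) \<in> entourage W" "(y, z) \<in> entourage W"
  shows "(w, z) \<in> entourage V"
proof -
  obtain A1 A2 A3 where A: "A1 \<in> W" "w \<in> A1" "x \<in> A1" "A2 \<in> W" "x \<in> A2" "y \<in> A2"
    "A3 \<in> W" "y \<in> A3" "z \<in> A3"
    using assms(2-4) unfolding entourage_def by blast
  obtain B where "B \<in> V" "star A2 W \<subseteq> B"
    using assms(1) A unfolding star_refined_by_def by blast
  moreover have "A1 \<subseteq> star A2 W" "A3 \<subseteq> star A2 W" using A unfolding star_def by blast+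
  ultimately have "w \<in> B" "z \<in> B" using A by auto
  then show ?thesis using \<open>B \<in> V\<close> unfolding entourage_def by blast
qed

lemma uniformity_cover: "cover_uniformity X \<mu> \<Longrightarrow> U \<in> \<mu> \<Longrightarrow> \<Union>U = X"
  unfolding cover_uniformity_def cover_of_def by simp

lemma uniformity_upward:
  "cover_uniformity X \<mu> \<Longrightarrow> U \<in> \<mu> \<Longrightarrow> \<Union>V = X \<Longrightarrow> refined_by V U \<Longrightarrow> V \<in> \<mu>"
  unfolding cover_uniformity_def cover_of_def by metis

lemma uniformity_nonempty: "cover_uniformity X \<mu> \<Longrightarrow> \<exists>U. U \<in> \<mu>"
  unfolding cover_uniformity_def by blast

text \<open>
  Every uniform cover \<open>U\<close> admits a uniformly continuous pseudometric such that points at distance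
  less than one share a member of \<open>U\<close>; it is built from a sequence of successive star-refinements.
\<close>

lemma uniform_pseudometric:
  assumes \<mu>: "cover_uniformity X \<mu>" and U: "U \<in> \<mu>"
  obtains d :: "'a \<Rightarrow> 'a \<Rightarrow> real" where "pseudometric d"
    "\<And>x y. x \<in> X \<Longrightarrow> y \<in> X \<Longrightarrow> d x y < 1 \<Longrightarrow> (x, y) \<in> entourage U"
    "\<And>e. e > 0 \<Longrightarrow> \<exists>V\<in>\<mu>. \<forall>A\<in>V. \<forall>x\<in>A. \<forall>y\<in>A. d x y < e"
proof -
  have "\<exists>V. \<forall>n. (V n \<in> \<mu> \<and> (n = 0 \<longrightarrow> V n = U)) \<and> star_refined_by (V n) (V (Suc n))"
  proof (rule dependent_nat_choice)
    show "\<exists>W. W \<in> \<mu> \<and> ((0::nat) = 0 \<longrightarrow> W = U)" using U by blast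
    fix W and n :: nat
    assume "W \<in> \<mu> \<and> (n = 0 \<longrightarrow> W = U)"
    then show "\<exists>W'. (W' \<in> \<mu> \<and> (Suc n = 0 \<longrightarrow> W' = U)) \<and> star_refined_by W W'"
      using \<mu> unfolding cover_uniformity_def by blast
  qed
  then obtain V where V: "\<And>n. V n \<in> \<mu>" "V 0 = U" "\<And>n. star_refined_by (V n) (V (Suc n))"
    by blast
  \<comment> \<open>Adding the diagonal makes the relations reflexive on the whole type, also outside \<open>X\<close>.\<close>
  define E where "E n = entourage (V n) \<union> Id" for n
  have cov: "x \<in> X \<Longrightarrow> (x, x) \<in> entourage (V n)" for n x
    using uniformity_cover[OF \<mu> V(1)] unfolding entourage_def by blast
  have inX: "x \<in> X \<and> y \<in> X" if "(x, y) \<in> entourage (V n)" for n x y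
    using uniformity_cover[OF \<mu> V(1)] that unfolding entourage_def by blast
  have comp: "(w, z) \<in> E n" if "(w, x) \<in> E (Suc n)" "(x, y) \<in> E (Suc n)" "(y, z) \<in> E (Suc n)"
    for n w x y z
  proof (cases "w \<in> X")
    case True
    then have "x \<in> X" "y \<in> X" "z \<in> X" using that inX by (auto simp: E_def)
    then have "(w, x) \<in> entourage (V (Suc n))" "(x, y) \<in> entourage (V (Suc n))"
      "(y, z) \<in> entourage (V (Suc n))"
      using that cov True by (auto simp: E_def)
    then show ?thesis using entourage_comp[OF V(3)] by (auto simp: E_def)
  next
    case False
    then have "w = x" "x = y" "y = z" using that inX by (auto simp: E_def)
    then show ?thesis by (simp add: E_def)
  qed
  have symE: "sym (E n)" for n
    unfolding E_def by (intro sym_Un sym_entourage sym_Id)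
  have reflE: "(x, x) \<in> E n" for n x by (simp add: E_def)
  have "\<exists>d. pseudometric d \<and> (\<forall>x y. d x y < 1 \<longrightarrow> (x, y) \<in> E 0) \<and>
      (\<forall>n x y. (x, y) \<in> E n \<longrightarrow> d x y \<le> (1/2)^n)"
    by (rule pseudometric_from_entourages) (fact reflE symE comp)+
  then obtain d where d: "pseudometric d" "\<And>x y. d x y < 1 \<Longrightarrow> (x, y) \<in> E 0"
    "\<And>n x y. (x, y) \<in> E n \<Longrightarrow> d x y \<le> (1/2)^n"
    by blast
  show thesis
  proof (rule that[of d, OF d(1)])
    show "(x, y) \<in> entourage U" if "x \<in> X" "y \<in> X" "d x y < 1" for x y
      using d(2)[OF that(3)] cov[of x 0] that V(2) by (auto simp: E_def)
    show "\<exists>V\<in>\<mu>. \<forall>A\<in>V. \<forall>x\<in>A. \<forall>y\<in>A. d x y < e" if e: "e > 0" for e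
    proof -
      obtain n where "(1/2) ^ n < e" using real_arch_pow_inv[OF e, of "1/2"] by auto
      have "d x y < e" if "A \<in> V n" "x \<in> A" "y \<in> A" for A x y
      proof -
        have "(x, y) \<in> E n" using that by (auto simp: E_def entourage_def)
        then show ?thesis using d(3) \<open>(1/2) ^ n < e\<close> by (meson le_less_trans)
      qed
      then show ?thesis using V(1)[of n] by (intro bexI[of _ "V n"]) auto
    qed
  qed
qed

section \<open>Uniformly continuous maps\<close>

lemma unif_continuous_compose:
  assumes f: "unif_continuous X \<mu> Y \<nu> f" and g: "unif_continuous Y \<nu> Z \<rho> g"
  shows "unif_continuous X \<mu> Z \<rho> (\<lambda>x. g (f x))"
  unfolding unif_continuous_def
proof (intro conjI ballI)
  show "(\<lambda>x. g (f x)) ` X \<subseteq> Z" using f g unfolding unif_continuous_def by blast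
  fix V assume "V \<in> \<rho>"
  then have "(\<lambda>C. f -` C \<inter> X) ` (\<lambda>B. g -` B \<inter> Y) ` V \<in> \<mu>"
    using f g unfolding unif_continuous_def by blast
  moreover have "(\<lambda>C. f -` C \<inter> X) ` (\<lambda>B. g -` B \<inter> Y) ` V = (\<lambda>B. (\<lambda>x. g (f x)) -` B \<inter> X) ` V"
  proof -
    have "f ` X \<subseteq> Y" using f unfolding unif_continuous_def by blast
    then have "f -` (g -` B \<inter> Y) \<inter> X = (\<lambda>x. g (f x)) -` B \<inter> X" for B by blast
    then show ?thesis by (simp add: image_image)
  qed
  ultimately show "(\<lambda>B. (\<lambda>x. g (f x)) -` B \<inter> X) ` V \<in> \<mu>" by simp
qed

lemma unif_continuous_imp_continuous_map:
  assumes \<mu>: "cover_uniformity X \<mu>" and \<nu>: "cover_uniformity Y \<nu>"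
    and f: "unif_continuous X \<mu> Y \<nu> f"
  shows "continuous_map (unif_topology X \<mu>) (unif_topology Y \<nu>) f"
proof -
  have "openin (unif_topology X \<mu>) {x \<in> X. f x \<in> G}" if G: "openin (unif_topology Y \<nu>) G" for G
    unfolding openin_unif_topology[OF \<mu>]
  proof (intro conjI ballI)
    fix x assume x: "x \<in> {x \<in> X. f x \<in> G}"
    then obtain V where V: "V \<in> \<nu>" "star {f x} V \<subseteq> G"
      using openin_unif_topology[OF \<nu>, THEN iffD1, OF G] by blast
    have "star {x} ((\<lambda>B. f -` B \<inter> X) ` V) \<subseteq> {x \<in> X. f x \<in> G}"
      using V(2) unfolding star_def by auto
    then show "\<exists>U\<in>\<mu>. star {x} U \<subseteq> {x \<in> X. f x \<in> G}"
      using f V(1) unfolding unif_continuous_def by blast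
  qed blast
  moreover have "f ` X \<subseteq> Y" using f unfolding unif_continuous_def by blast
  ultimately show ?thesis
    using \<mu> \<nu> unfolding continuous_map_def by auto
qed

text \<open>
  It suffices that for each \<open>V \<in> \<nu>\<close> the images of the members of some uniform cover of the domain
  refine \<open>V\<close>.
\<close>

lemma unif_continuousI:
  assumes \<mu>: "cover_uniformity X \<mu>" and \<nu>: "\<And>V. V \<in> \<nu> \<Longrightarrow> \<Union>V = Y" and f: "f ` X \<subseteq> Y"
    and W: "\<And>V. V \<in> \<nu> \<Longrightarrow> \<exists>W\<in>\<mu>. \<forall>A\<in>W. \<exists>B\<in>V. f ` A \<subseteq> B"
  shows "unif_continuous X \<mu> Y \<nu> f"
  unfolding unif_continuous_def
proof (intro conjI ballI)
  fix V assume V: "V \<in> \<nu>"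
  then obtain W where W: "W \<in> \<mu>" "\<forall>A\<in>W. \<exists>B\<in>V. f ` A \<subseteq> B"
    using assms(4)[OF V] by (elim bexE)
  show "(\<lambda>B. f -` B \<inter> X) ` V \<in> \<mu>"
  proof (rule uniformity_upward[OF \<mu> W(1)])
    have "f ` X \<subseteq> \<Union>V" using f \<nu>[OF V] by simp
    then show "\<Union>((\<lambda>B. f -` B \<inter> X) ` V) = X" by blast
    have "\<Union>W = X" using uniformity_cover[OF \<mu> W(1)] .
    have "\<exists>B\<in>V. A \<subseteq> f -` B \<inter> X" if A: "A \<in> W" for A
    proof -
      obtain B where "B \<in> V" "f ` A \<subseteq> B" using bspec[OF W(2) A] by (elim bexE)
      moreover have "A \<subseteq> X" using A \<open>\<Union>W = X\<close> by blast
      ultimately show ?thesis by (intro bexI[of _ B]) auto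
    qed
    then show "refined_by ((\<lambda>B. f -` B \<inter> X) ` V) W" by (simp add: refined_by_def)
  qed
qed (rule f)

lemma uniformity_common_refinement:
  assumes \<mu>: "cover_uniformity X \<mu>" and "finite K" and "\<And>k. k \<in> K \<Longrightarrow> U k \<in> \<mu>"
  shows "\<exists>W\<in>\<mu>. \<forall>k\<in>K. refined_by (U k) W"
  using assms(2,3)
proof (induction K)
  case empty
  then show ?case using uniformity_nonempty[OF \<mu>] by blast
next
  case (insert k K)
  then obtain W where W: "W \<in> \<mu>" "\<forall>k\<in>K. refined_by (U k) W" by auto
  obtain W' where W': "W' \<in> \<mu>" "star_refined_by (U k) W'" "star_refined_by W W'"
    using \<mu> W(1) insert.prems[of k] unfolding cover_uniformity_def by blast
  then show ?case using W(2) star_refined_byD refined_by_trans by (metis insert_iff)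
qed

lemma unif_continuous_prod:
  assumes \<mu>: "cover_uniformity X \<mu>"
    and PiE: "\<And>x. x \<in> X \<Longrightarrow> f x \<in> PiE J Y"
    and f: "\<And>j. j \<in> J \<Longrightarrow> unif_continuous X \<mu> (Y j) (\<nu> j) (\<lambda>x. f x j)"
  shows "unif_continuous X \<mu> (PiE J Y) (prod_uniformity J Y \<nu>) f"
proof (rule unif_continuousI[OF \<mu>])
  show "\<Union>V = PiE J Y" if "V \<in> prod_uniformity J Y \<nu>" for V
    using that unfolding prod_uniformity_def cover_of_def by simp
  show "f ` X \<subseteq> PiE J Y" using PiE by blast
  fix V assume "V \<in> prod_uniformity J Y \<nu>"
  then obtain K U where K: "finite K" "K \<subseteq> J" "\<And>k. k \<in> K \<Longrightarrow> U k \<in> \<nu> k"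
    and V: "refined_by V {{f \<in> PiE J Y. \<forall>k\<in>K. f k \<in> B k} | B. \<forall>k\<in>K. B k \<in> U k}"
    unfolding prod_uniformity_def by blast
  define U' where "U' k = (\<lambda>B. (\<lambda>x. f x k) -` B \<inter> X) ` U k" for k
  have "U' k \<in> \<mu>" if "k \<in> K" for k
    using f[of k] K that unfolding unif_continuous_def U'_def by blast
  then obtain W where W: "W \<in> \<mu>" "\<forall>k\<in>K. refined_by (U' k) W"
    using uniformity_common_refinement[OF \<mu> K(1)] by blast
  have "\<exists>B\<in>V. f ` A \<subseteq> B" if A: "A \<in> W" for A
  proof -
    have "\<forall>k\<in>K. \<exists>B. B \<in> U k \<and> A \<subseteq> (\<lambda>x. f x k) -` B"
      using W(2) A unfolding refined_by_def U'_def by fast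
    then obtain B where B: "\<forall>k\<in>K. B k \<in> U k \<and> A \<subseteq> (\<lambda>x. f x k) -` B k" by metis
    have "A \<subseteq> X" using A uniformity_cover[OF \<mu> W(1)] by blast
    then have "f ` A \<subseteq> {f \<in> PiE J Y. \<forall>k\<in>K. f k \<in> B k}"
      using B by (intro image_subsetI CollectI conjI ballI PiE) auto
    moreover have "\<exists>C\<in>V. {f \<in> PiE J Y. \<forall>k\<in>K. f k \<in> B k} \<subseteq> C"
      using V B unfolding refined_by_def by blast
    ultimately show ?thesis by (meson order_trans)
  qed
  then show "\<exists>W\<in>\<mu>. \<forall>A\<in>W. \<exists>B\<in>V. f ` A \<subseteq> B" using W(1) by blast
qed

lemma unif_continuous_pair:
  assumes \<mu>: "cover_uniformity X \<mu>"
    and f: "unif_continuous X \<mu> Y \<nu> f" and g: "unif_continuous X \<mu> Z \<rho> g"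
  shows "unif_continuous X \<mu> (Y \<times> Z) (pair_uniformity Y \<nu> Z \<rho>) (\<lambda>x. (f x, g x))"
proof (rule unif_continuousI[OF \<mu>])
  show "\<Union>V = Y \<times> Z" if "V \<in> pair_uniformity Y \<nu> Z \<rho>" for V
    using that unfolding pair_uniformity_def cover_of_def by simp
  show "(\<lambda>x. (f x, g x)) ` X \<subseteq> Y \<times> Z" using f g unfolding unif_continuous_def by blast
  fix V assume "V \<in> pair_uniformity Y \<nu> Z \<rho>"
  then obtain U U' where U: "U \<in> \<nu>" "U' \<in> \<rho>" "refined_by V {A \<times> B | A B. A \<in> U \<and> B \<in> U'}"
    unfolding pair_uniformity_def by blast
  then have "(\<lambda>B. f -` B \<inter> X) ` U \<in> \<mu>" "(\<lambda>B. g -` B \<inter> X) ` U' \<in> \<mu>"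
    using f g unfolding unif_continuous_def by blast+
  then obtain W where W: "W \<in> \<mu>" "star_refined_by ((\<lambda>B. f -` B \<inter> X) ` U) W"
    "star_refined_by ((\<lambda>B. g -` B \<inter> X) ` U') W"
    using \<mu> unfolding cover_uniformity_def by blast
  have "\<exists>B\<in>V. (\<lambda>x. (f x, g x)) ` A \<subseteq> B" if A: "A \<in> W" for A
  proof -
    obtain B where B: "B \<in> U" "A \<subseteq> f -` B"
      using star_refined_byD[OF W(2)] A unfolding refined_by_def by fast
    obtain B' where B': "B' \<in> U'" "A \<subseteq> g -` B'"
      using star_refined_byD[OF W(3)] A unfolding refined_by_def by fast
    obtain C where "C \<in> V" "B \<times> B' \<subseteq> C" using U(3) B B' unfolding refined_by_def by blast
    moreover have "(\<lambda>x. (f x, g x)) ` A \<subseteq> B \<times> B'" using B B' by blast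
    ultimately show ?thesis by (meson order_trans)
  qed
  then show "\<exists>W\<in>\<mu>. \<forall>A\<in>W. \<exists>B\<in>V. (\<lambda>x. (f x, g x)) ` A \<subseteq> B" using W(1) by blast
qed

lemma unif_continuous_fst:
  assumes "cover_uniformity Y \<nu>" and "cover_uniformity Z \<rho>"
  shows "unif_continuous (Y \<times> Z) (pair_uniformity Y \<nu> Z \<rho>) Y \<nu> fst"
proof (rule unif_continuousI[OF cover_uniformity_pair[OF assms]])
  show "\<Union>V = Y" if "V \<in> \<nu>" for V using uniformity_cover[OF assms(1) that] .
  fix V assume V: "V \<in> \<nu>"
  obtain U where U: "U \<in> \<rho>" using uniformity_nonempty[OF assms(2)] by blast
  have "\<Union>{A \<times> B | A B. A \<in> V \<and> B \<in> U} = \<Union>V \<times> \<Union>U" by blast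
  then have "{A \<times> B | A B. A \<in> V \<and> B \<in> U} \<in> pair_uniformity Y \<nu> Z \<rho>"
    using uniformity_cover[OF assms(1) V] uniformity_cover[OF assms(2) U] V U refined_by_refl
    unfolding pair_uniformity_def cover_of_def by fastforce
  then show "\<exists>W\<in>pair_uniformity Y \<nu> Z \<rho>. \<forall>A\<in>W. \<exists>B\<in>V. fst ` A \<subseteq> B"
    by (rule bexI[rotated]) fastforce
qed auto

lemma unif_continuous_snd:
  assumes "cover_uniformity Y \<nu>" and "cover_uniformity Z \<rho>"
  shows "unif_continuous (Y \<times> Z) (pair_uniformity Y \<nu> Z \<rho>) Z \<rho> snd"
proof (rule unif_continuousI[OF cover_uniformity_pair[OF assms]])
  show "\<Union>V = Z" if "V \<in> \<rho>" for V using uniformity_cover[OF assms(2) that] .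
  fix V assume V: "V \<in> \<rho>"
  obtain U where U: "U \<in> \<nu>" using uniformity_nonempty[OF assms(1)] by blast
  have "\<Union>{A \<times> B | A B. A \<in> U \<and> B \<in> V} = \<Union>U \<times> \<Union>V" by blast
  then have "{A \<times> B | A B. A \<in> U \<and> B \<in> V} \<in> pair_uniformity Y \<nu> Z \<rho>"
    using uniformity_cover[OF assms(1) U] uniformity_cover[OF assms(2) V] V U refined_by_refl
    unfolding pair_uniformity_def cover_of_def by fastforce
  then show "\<exists>W\<in>pair_uniformity Y \<nu> Z \<rho>. \<forall>A\<in>W. \<exists>B\<in>V. snd ` A \<subseteq> B"
    by (rule bexI[rotated]) fastforce
qed auto

lemma unif_continuous_proj:
  assumes \<nu>: "\<And>j. j \<in> J \<Longrightarrow> cover_uniformity (Y j) (\<nu> j)" and j: "j \<in> J"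
  shows "unif_continuous (PiE J Y) (prod_uniformity J Y \<nu>) (Y j) (\<nu> j) (\<lambda>f. f j)"
proof (rule unif_continuousI[OF cover_uniformity_prod[of J Y \<nu>, OF \<nu>]])
  show "\<Union>V = Y j" if "V \<in> \<nu> j" for V using uniformity_cover[OF \<nu>[OF j] that] .
  show "(\<lambda>f. f j) ` PiE J Y \<subseteq> Y j" using j by auto
  fix V assume V: "V \<in> \<nu> j"
  let ?W = "{{f \<in> PiE J Y. \<forall>k\<in>{j}. f k \<in> B k} | B. \<forall>k\<in>{j}. B k \<in> (\<lambda>_. V) k}"
  have "cover_of (PiE J Y) ?W"
    unfolding cover_of_def
  proof (intro subset_antisym subsetI)
    fix f assume f: "f \<in> PiE J Y"
    then obtain B where "B \<in> V" "f j \<in> B" using uniformity_cover[OF \<nu>[OF j] V] j by blast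
    then show "f \<in> \<Union>?W" using f by (intro UnionI[of "{f \<in> PiE J Y. f j \<in> B}"]) auto
  qed blast
  then have "?W \<in> prod_uniformity J Y \<nu>"
    unfolding prod_uniformity_def using j V
    by (intro CollectI conjI exI[of _ "{j}"] exI[of _ "\<lambda>_. V"]) (auto simp: refined_by_refl)
  then show "\<exists>W\<in>prod_uniformity J Y \<nu>. \<forall>A\<in>W. \<exists>B\<in>V. (\<lambda>f. f j) ` A \<subseteq> B"
    by (rule bexI[rotated]) fastforce
qed

lemma openin_mball_unif_topology:
  "openin (unif_topology (mspace m) (metric_uniformity m)) (mball_of m x e)"
  unfolding openin_unif_topology[OF cover_uniformity_metric]
proof (intro conjI ballI)
  interpret Metric_space "mspace m" "mdist m" by (rule Metric_space_mspace_mdist)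
  show "mball_of m x e \<subseteq> mspace m" by auto
  fix y assume y: "y \<in> mball_of m x e"
  define r where "r = (e - mdist m x y) / 2"
  have r: "r > 0" using y by (simp add: r_def)
  let ?U = "{mball_of m z r | z. z \<in> mspace m}"
  have "\<Union>?U = mspace m"
  proof (intro subset_antisym subsetI)
    fix z assume "z \<in> mspace m"
    then have "z \<in> mball_of m z r" using r by simp
    then show "z \<in> \<Union>?U" using \<open>z \<in> mspace m\<close> by blast
  qed auto
  then have "?U \<in> metric_uniformity m"
    unfolding metric_uniformity_def cover_of_def using r refined_by_refl by blast
  moreover have "star {y} ?U \<subseteq> mball_of m x e"
  proof
    fix w assume "w \<in> star {y} ?U"
    then obtain z where z: "z \<in> mspace m" "y \<in> mball_of m z r" "w \<in> mball_of m z r"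
      unfolding star_def by blast
    have "mdist m y w \<le> mdist m y z + mdist m z w" "mdist m x w \<le> mdist m x y + mdist m y w"
      using y z triangle by auto
    then have "mdist m x w < e" using z commute[of y z] by (simp add: r_def)
    then show "w \<in> mball_of m x e" using y z by simp
  qed
  ultimately show "\<exists>U\<in>metric_uniformity m. star {y} U \<subseteq> mball_of m x e" by blast
qed

text \<open>The uniform structure of the real line.\<close>

abbreviation real_uniformity :: "real set set set" where
  "real_uniformity \<equiv> metric_uniformity euclidean_metric"

lemma unif_continuous_realI:
  fixes f :: "'a \<Rightarrow> real"
  assumes \<mu>: "cover_uniformity X \<mu>"
    and f: "\<And>e. e > 0 \<Longrightarrow> \<exists>U\<in>\<mu>. \<forall>A\<in>U. \<forall>x\<in>A. \<forall>y\<in>A. \<bar>f x - f y\<bar> < e"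
  shows "unif_continuous X \<mu> UNIV real_uniformity f"
proof (rule unif_continuousI[OF \<mu>])
  fix V :: "real set set" assume "V \<in> real_uniformity"
  then obtain e where e: "e > 0" "refined_by V {mball_of euclidean_metric x e | x. x \<in> UNIV}"
    unfolding metric_uniformity_def by auto
  have ball: "\<exists>B\<in>V. mball_of euclidean_metric c e \<subseteq> B" for c
    using e(2) unfolding refined_by_def by blast
  obtain U where U: "U \<in> \<mu>" "\<forall>A\<in>U. \<forall>x\<in>A. \<forall>y\<in>A. \<bar>f x - f y\<bar> < e" using f e(1) by blast
  have "\<exists>B\<in>V. f ` A \<subseteq> B" if "A \<in> U" for A
  proof -
    have "\<exists>c. \<forall>x\<in>A. \<bar>c - f x\<bar> < e" using U(2) that by (cases "A = {}") blast+
    then obtain c where "\<forall>x\<in>A. \<bar>c - f x\<bar> < e" by blast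
    then have "f ` A \<subseteq> mball_of euclidean_metric c e" by (auto simp: dist_real_def)
    then show ?thesis using ball by (meson order_trans)
  qed
  then show "\<exists>W\<in>\<mu>. \<forall>A\<in>W. \<exists>B\<in>V. f ` A \<subseteq> B" using U(1) by blast
qed (auto simp: metric_uniformity_def cover_of_def)

lemma unif_continuous_pseudometric:
  assumes \<mu>: "cover_uniformity X \<mu>" and d: "pseudometric d"
    and u: "\<And>e. e > 0 \<Longrightarrow> \<exists>V\<in>\<mu>. \<forall>A\<in>V. \<forall>x\<in>A. \<forall>y\<in>A. d x y < e"
  shows "unif_continuous X \<mu> UNIV real_uniformity (d a)"
proof (rule unif_continuous_realI[OF \<mu>])
  fix e :: real assume "e > 0"
  then obtain V where V: "V \<in> \<mu>" "\<forall>A\<in>V. \<forall>x\<in>A. \<forall>y\<in>A. d x y < e" using u by blast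
  have "\<bar>d a x - d a y\<bar> \<le> d x y" for x y
    using pseudometric_triangle[OF d, of a x y] pseudometric_triangle[OF d, of a y x]
      pseudometric_sym[OF d, of x y] by linarith
  then show "\<exists>U\<in>\<mu>. \<forall>A\<in>U. \<forall>x\<in>A. \<forall>y\<in>A. \<bar>d a x - d a y\<bar> < e"
    using V by (meson le_less_trans)
qed

text \<open>
  A map to a discrete space is uniformly continuous if its fibres form a uniform cover.
\<close>

lemma unif_continuous_discrete:
  assumes \<mu>: "cover_uniformity X \<mu>" and P: "P \<in> \<mu>"
    and const: "\<And>A. A \<in> P \<Longrightarrow> \<exists>c\<in>D. \<forall>x\<in>A. f x = c"
  shows "unif_continuous X \<mu> D (metric_uniformity (discrete_metric_on D)) f"
proof (rule unif_continuousI[OF \<mu>])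
  show cov: "\<Union>V = D" if "V \<in> metric_uniformity (discrete_metric_on D)" for V
    using that unfolding metric_uniformity_def cover_of_def by simp
  show "f ` X \<subseteq> D" using const uniformity_cover[OF \<mu> P] by fastforce
  fix V assume V: "V \<in> metric_uniformity (discrete_metric_on D)"
  have "\<exists>B\<in>V. f ` A \<subseteq> B" if A: "A \<in> P" for A
  proof -
    obtain c where c: "c \<in> D" "\<forall>x\<in>A. f x = c" using const[OF A] by blast
    then obtain B where "B \<in> V" "c \<in> B" using cov[OF V] by blast
    then show ?thesis using c by (intro bexI[of _ B]) auto
  qed
  then show "\<exists>W\<in>\<mu>. \<forall>A\<in>W. \<exists>B\<in>V. f ` A \<subseteq> B" using P by blast
qed

section \<open>Chain components and coarse distance functions\<close>

text \<open>
  An integer-valued function that changes by at most one within the members of a uniform cover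
  need not be uniformly continuous, but it is at bounded distance from a uniformly continuous
  function. The smoothing interpolates with a pseudometric \<open>d\<close> whose balls of radius one are
  subordinate to the cover. In the infimum only points \<open>y\<close> with \<open>N y \<ge> N x - 1\<close> compete, because
  \<open>d\<close> may be bounded and so does not keep points with much smaller values of \<open>N\<close> away.
\<close>

lemma uniform_smoothing:
  fixes N :: "'a \<Rightarrow> nat"
  assumes \<mu>: "cover_uniformity X \<mu>" and U: "U \<in> \<mu>"
    and N: "\<And>x y. (x, y) \<in> entourage U \<Longrightarrow> N x \<le> N y + 1"
  obtains \<rho> where "unif_continuous X \<mu> UNIV real_uniformity \<rho>"
    "\<And>x. x \<in> X \<Longrightarrow> real (N x) \<le> \<rho> x + 1"
proof -
  obtain d where d: "pseudometric d"
    and dU: "\<And>x y. x \<in> X \<Longrightarrow> y \<in> X \<Longrightarrow> d x y < 1 \<Longrightarrow> (x, y) \<in> entourage U"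
    and du: "\<And>e. e > 0 \<Longrightarrow> \<exists>V\<in>\<mu>. \<forall>A\<in>V. \<forall>x\<in>A. \<forall>y\<in>A. d x y < e"
    using uniform_pseudometric[OF \<mu> U] by metis
  note dnn = pseudometric_nonneg[OF d] and dsym = pseudometric_sym[OF d]
    and dtri = pseudometric_triangle[OF d]
  define S where "S x = {real (N y) + d x y | y. y \<in> X \<and> N x \<le> N y + 1}" for x
  define \<rho> where "\<rho> x = Inf (S x)" for x
  have bdd: "bdd_below (S x)" for x
    using dnn by (intro bdd_belowI[of _ 0]) (auto simp: S_def)
  have ne: "S x \<noteq> {}" if "x \<in> X" for x using that unfolding S_def by auto
  have lower: "\<rho> x \<le> real (N y) + d x y" if "y \<in> X" "N x \<le> N y + 1" for x y
    unfolding \<rho>_def using that bdd by (intro cInf_lower) (auto simp: S_def)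
  have greatest: "t \<le> \<rho> x"
    if "x \<in> X" "\<And>y. y \<in> X \<Longrightarrow> N x \<le> N y + 1 \<Longrightarrow> t \<le> real (N y) + d x y" for t x
    unfolding \<rho>_def using that(2) by (intro cInf_greatest ne[OF that(1)]) (auto simp: S_def)
  have near: "N x \<le> N y + 1" if "x \<in> X" "y \<in> X" "d x y < 1" for x y
    using N dU that by blast
  have step: "\<rho> x' \<le> \<rho> x + 2 * d x x'" if x: "x \<in> X" "x' \<in> X" "d x x' < 1" for x x'
  proof -
    have "\<rho> x' - 2 * d x x' \<le> real (N y) + d x y" if y: "y \<in> X" "N x \<le> N y + 1" for y
    proof (cases "N x' \<le> N y + 1")
      case True
      then have "\<rho> x' \<le> real (N y) + d x' y" using lower y by blast
      then show ?thesis using dtri[of x' y x] dsym[of x x'] dnn[of x x'] by linarith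
    next
      case False
      \<comment> \<open>Here \<open>N y + 1 = N x = N x' - 1\<close>, so \<open>y\<close> is far from \<open>x'\<close> and \<open>x\<close> itself competes.\<close>
      have N': "N x' \<le> N x + 1" using near[of x' x] x dsym[of x x'] by simp
      have "d x' y \<ge> 1" using near[of x' y] x y False by linarith
      moreover have "\<rho> x' \<le> real (N x) + d x' x" using lower[of x x'] x N' by blast
      ultimately show ?thesis using dtri[of x' y x] dsym[of x x'] y by linarith
    qed
    then have "\<rho> x' - 2 * d x x' \<le> \<rho> x" by (intro greatest x)
    then show ?thesis by simp
  qed
  show thesis
  proof
    show "real (N x) \<le> \<rho> x + 1" if "x \<in> X" for x
    proof -
      have "real (N x) - 1 \<le> \<rho> x"
      proof (rule greatest[OF that])
        fix y assume "N x \<le> N y + 1"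
        then show "real (N x) - 1 \<le> real (N y) + d x y" using dnn[of x y] by linarith
      qed
      then show ?thesis by simp
    qed
    show "unif_continuous X \<mu> UNIV real_uniformity \<rho>"
    proof (rule unif_continuous_realI[OF \<mu>])
      fix e :: real assume e: "e > 0"
      obtain V where V: "V \<in> \<mu>" "\<forall>A\<in>V. \<forall>x\<in>A. \<forall>y\<in>A. d x y < min 1 (e / 2)"
        using du[of "min 1 (e / 2)"] e by auto
      have "\<bar>\<rho> x - \<rho> y\<bar> < e" if A: "A \<in> V" "x \<in> A" "y \<in> A" for A x y
      proof -
        have "x \<in> X" "y \<in> X" using uniformity_cover[OF \<mu> V(1)] A by auto
        moreover have "d x y < 1" "d x y < e / 2" using V(2) A by auto
        ultimately show ?thesis using step[of x y] step[of y x] dsym[of x y] by (simp add: abs_if)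
      qed
      then show "\<exists>U\<in>\<mu>. \<forall>A\<in>U. \<forall>x\<in>A. \<forall>y\<in>A. \<bar>\<rho> x - \<rho> y\<bar> < e"
        using V(1) by (intro bexI[of _ V]) auto
    qed
  qed
qed

text \<open>The points reachable from \<open>x\<close> by finite chains of members of \<open>U\<close>.\<close>

definition chain_component :: "'a set set \<Rightarrow> 'a \<Rightarrow> 'a set" where
  "chain_component U x = (entourage U)\<^sup>* `` {x}"

lemma chain_component_refl: "x \<in> chain_component U x"
  unfolding chain_component_def by simp

lemma chain_component_eq:
  assumes "y \<in> chain_component U x" shows "chain_component U y = chain_component U x"
proof -
  have xy: "(x, y) \<in> (entourage U)\<^sup>*" using assms unfolding chain_component_def by simp
  then have "(y, x) \<in> (entourage U)\<^sup>*" using sym_rtrancl[OF sym_entourage] by (metis symE)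
  then show ?thesis using xy unfolding chain_component_def by (auto intro: rtrancl_trans)
qed

lemma chain_component_subset:
  assumes "\<Union>U = X" and "x \<in> X" shows "chain_component U x \<subseteq> X"
proof
  fix y assume "y \<in> chain_component U x"
  then have "(x, y) \<in> (entourage U)\<^sup>*" unfolding chain_component_def by simp
  then show "y \<in> X" by (induction) (use assms in \<open>auto simp: entourage_def\<close>)
qed

text \<open>
  The space has to be nonempty, because on the empty space \<open>{{}}\<close> may be the only uniform cover, and
  it is not a partition.
\<close>

lemma uniform_partition_chain_components:
  assumes \<mu>: "cover_uniformity X \<mu>" and U: "U \<in> \<mu>" and X: "X \<noteq> {}"
  shows "uniform_partition X \<mu> (chain_component U ` X)"
proof -
  note cov = uniformity_cover[OF \<mu> U]
  have Un: "\<Union>(chain_component U ` X) = X"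
    using chain_component_subset[OF cov] chain_component_refl by fast
  have "refined_by (chain_component U ` X) U"
    unfolding refined_by_def
  proof
    fix A assume A: "A \<in> U"
    show "\<exists>B\<in>chain_component U ` X. A \<subseteq> B"
    proof (cases "A = {}")
      case True
      then show ?thesis using X by blast
    next
      case False
      then obtain x where x: "x \<in> A" by blast
      have "A \<subseteq> chain_component U x"
        using A x unfolding chain_component_def entourage_def by auto
      moreover have "x \<in> X" using A x cov by blast
      ultimately show ?thesis by blast
    qed
  qed
  then have "chain_component U ` X \<in> \<mu>" by (rule uniformity_upward[OF \<mu> U Un])
  moreover have "partition_on X (chain_component U ` X)"
  proof (rule partition_onI)
    fix C D assume CD: "C \<in> chain_component U ` X" "D \<in> chain_component U ` X" "C \<noteq> D"
    then obtain x y where xy: "C = chain_component U x" "D = chain_component U y" by blast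
    show "disjnt C D"
    proof (rule ccontr)
      assume "\<not> disjnt C D"
      then obtain z where "z \<in> C" "z \<in> D" by (auto simp: disjnt_def)
      then show False using chain_component_eq CD(3) xy by metis
    qed
  next
    show "\<Union>(chain_component U ` X) = X" by (rule Un)
    show "{} \<notin> chain_component U ` X" using chain_component_refl by fastforce
  qed
  ultimately show ?thesis unfolding uniform_partition_def by blast
qed

lemma star_iter_le:
  assumes "A \<subseteq> \<Union>U" and "k \<le> m"
  shows "star_iter k A U \<subseteq> star_iter m A U"
proof -
  have "star_iter n A U \<subseteq> \<Union>U" for n
    by (cases n) (use assms(1) in \<open>auto simp: star_def\<close>)
  then have "star_iter n A U \<subseteq> star (star_iter n A U) U" for n unfolding star_def by blast
  then have "star_iter n A U \<subseteq> star_iter (Suc n) A U" for n by simp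
  then show ?thesis using assms(2) by (rule lift_Suc_mono_le)
qed

lemma relpow_entourage_star_iter:
  assumes "b \<in> A" and "(b, y) \<in> entourage U ^^ m"
  shows "y \<in> star_iter m A U"
  using assms(2)
proof (induction m arbitrary: y)
  case (Suc m)
  then obtain z where "(b, z) \<in> entourage U ^^ m" "(z, y) \<in> entourage U" by auto
  then obtain B where "z \<in> star_iter m A U" "B \<in> U" "z \<in> B" "y \<in> B"
    using Suc.IH unfolding entourage_def by blast
  then have "y \<in> star (star_iter m A U) U" unfolding star_def by blast
  then show ?case by simp
qed (use assms(1) in simp)

text \<open>
  On each chain component the function \<open>N\<close> in the proof counts the links of a shortest chain from a base
  point of the component. Its smoothing is uniformly continuous, and the parts of the component on
  which it is bounded lie in a finite iterated star of one member of \<open>U\<close>.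
\<close>

lemma coarse_distance:
  assumes \<mu>: "cover_uniformity X \<mu>" and U: "U \<in> \<mu>"
  obtains \<rho> where "unif_continuous X \<mu> UNIV real_uniformity \<rho>"
    "\<And>C M. C \<in> chain_component U ` X \<Longrightarrow>
      \<exists>m. \<exists>A\<in>U. \<forall>x\<in>C. \<rho> x < M \<longrightarrow> x \<in> star_iter m A U"
proof -
  note cov = uniformity_cover[OF \<mu> U]
  define b :: "'a set \<Rightarrow> 'a" where "b C = (SOME z. z \<in> C)" for C
  define N where "N x = (LEAST m. (b (chain_component U x), x) \<in> entourage U ^^ m)" for x
  have b: "b (chain_component U x) \<in> chain_component U x" for x
    unfolding b_def using chain_component_refl by (rule someI)
  have chain: "(b (chain_component U x), x) \<in> entourage U ^^ N x" for x
  proof -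
    have "x \<in> chain_component U (b (chain_component U x))"
      using chain_component_eq[OF b] chain_component_refl by metis
    then have "\<exists>m. (b (chain_component U x), x) \<in> entourage U ^^ m"
      unfolding chain_component_def using rtrancl_imp_relpow by fast
    then show ?thesis unfolding N_def by (rule LeastI_ex)
  qed
  have "N x \<le> N y + 1" if xy: "(x, y) \<in> entourage U" for x y
  proof -
    have "y \<in> chain_component U x" using xy unfolding chain_component_def by auto
    then have "chain_component U y = chain_component U x" by (rule chain_component_eq)
    moreover have "(y, x) \<in> entourage U" using xy sym_entourage by (metis symE)
    ultimately have "(b (chain_component U x), x) \<in> entourage U ^^ Suc (N y)"
      using chain[of y] by (metis relpow_Suc_I)
    then show ?thesis unfolding N_def[of x] by (metis Least_le Suc_eq_plus1)
  qed
  then obtain \<rho> where \<rho>: "unif_continuous X \<mu> UNIV real_uniformity \<rho>"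
    "\<And>x. x \<in> X \<Longrightarrow> real (N x) \<le> \<rho> x + 1"
    using uniform_smoothing[OF \<mu> U] by blast
  show thesis
  proof (rule that[OF \<rho>(1)])
    fix C M assume "C \<in> chain_component U ` X"
    then obtain c where c: "c \<in> X" "C = chain_component U c" by blast
    have "C \<subseteq> X" using chain_component_subset[OF cov c(1)] c(2) by simp
    then have "b C \<in> X" using b c by blast
    then obtain A where A: "A \<in> U" "b C \<in> A" using cov by blast
    obtain m :: nat where m: "M + 1 \<le> real m" using real_arch_simple by blast
    have "x \<in> star_iter m A U" if x: "x \<in> C" "\<rho> x < M" for x
    proof -
      have "real (N x) \<le> \<rho> x + 1" using \<rho>(2) x \<open>C \<subseteq> X\<close> by blast
      then have "N x \<le> m" using x(2) m by linarith
      moreover have "chain_component U x = C" using chain_component_eq x c by metis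
      then have "x \<in> star_iter (N x) A U"
        using relpow_entourage_star_iter[OF A(2)] chain[of x] by simp
      moreover have "A \<subseteq> \<Union>U" using A by blast
      ultimately show ?thesis using star_iter_le by blast
    qed
    then show "\<exists>m. \<exists>A\<in>U. \<forall>x\<in>C. \<rho> x < M \<longrightarrow> x \<in> star_iter m A U"
      using A(1) by (intro exI[of _ m] bexI[of _ A]) auto
  qed
qed

section \<open>Separation and embeddings through metric-valued maps\<close>

lemma openin_preimage_mball:
  assumes \<nu>: "cover_uniformity Y \<nu>"
    and f: "unif_continuous Y \<nu> (mspace m) (metric_uniformity m) f"
  shows "openin (unif_topology Y \<nu>) {y \<in> Y. f y \<in> mball_of m c e}"
  using openin_continuous_map_preimage[OF unif_continuous_imp_continuous_map[OF \<nu>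
      cover_uniformity_metric f] openin_mball_unif_topology] \<nu> by simp

lemma separated_by_metric_map:
  assumes \<nu>: "cover_uniformity Y \<nu>"
    and f: "unif_continuous Y \<nu> (mspace m) (metric_uniformity m) f"
    and pq: "p \<in> Y" "q \<in> Y" "f p \<noteq> f q"
  shows "\<exists>G H. openin (unif_topology Y \<nu>) G \<and> openin (unif_topology Y \<nu>) H \<and>
    p \<in> G \<and> q \<in> H \<and> disjnt G H"
proof -
  interpret Metric_space "mspace m" "mdist m" by (rule Metric_space_mspace_mdist)
  have m: "f p \<in> mspace m" "f q \<in> mspace m" using f pq unfolding unif_continuous_def by blast+
  define r where "r = mdist m (f p) (f q) / 2"
  have r: "r > 0" using m pq by (simp add: r_def)
  let ?B = "\<lambda>c. {y \<in> Y. f y \<in> mball_of m (f c) r}"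
  have "disjnt (?B p) (?B q)"
  proof -
    have False if y: "y \<in> ?B p" "y \<in> ?B q" for y
    proof -
      have "mdist m (f p) (f q) \<le> mdist m (f p) (f y) + mdist m (f y) (f q)"
        using y m triangle by auto
      then show False using y commute[of "f y" "f q"] by (simp add: r_def)
    qed
    then show ?thesis unfolding disjnt_def by blast
  qed
  moreover have "p \<in> ?B p" "q \<in> ?B q" using m pq r by auto
  ultimately show ?thesis using openin_preimage_mball[OF \<nu> f] by blast
qed

lemma embedding_map_if_separates:
  assumes cont: "continuous_map T T' \<phi>" and inj: "inj_on \<phi> (topspace T)"
    and sep: "\<And>G x. openin T G \<Longrightarrow> x \<in> G \<Longrightarrow>
      \<exists>W. openin T' W \<and> \<phi> x \<in> W \<and> (\<forall>z\<in>topspace T. \<phi> z \<in> W \<longrightarrow> z \<in> G)"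
  shows "embedding_map T T' \<phi>"
  unfolding embedding_map_def
proof (rule bijective_open_imp_homeomorphic_map)
  have sub: "\<phi> ` topspace T \<subseteq> topspace T'" using cont continuous_map_image_subset_topspace by blast
  show "continuous_map T (subtopology T' (\<phi> ` topspace T)) \<phi>"
    using cont by (simp add: continuous_map_in_subtopology)
  show "\<phi> ` topspace T = topspace (subtopology T' (\<phi> ` topspace T))"
    using sub by (simp add: topspace_subtopology Int_absorb1)
  show "open_map T (subtopology T' (\<phi> ` topspace T)) \<phi>"
    unfolding open_map_def
  proof (intro allI impI)
    fix G assume G: "openin T G"
    have "\<exists>H. openin (subtopology T' (\<phi> ` topspace T)) H \<and> y \<in> H \<and> H \<subseteq> \<phi> ` G"
      if y: "y \<in> \<phi> ` G" for y
    proof -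
      obtain x where x: "x \<in> G" "y = \<phi> x" using y by blast
      then obtain W where W: "openin T' W" "\<phi> x \<in> W" "\<forall>z\<in>topspace T. \<phi> z \<in> W \<longrightarrow> z \<in> G"
        using sep[OF G] by blast
      have "openin (subtopology T' (\<phi> ` topspace T)) (W \<inter> \<phi> ` topspace T)"
        using W(1) unfolding openin_subtopology by blast
      moreover have "y \<in> W \<inter> \<phi> ` topspace T" using x W(2) openin_subset[OF G] by blast
      moreover have "W \<inter> \<phi> ` topspace T \<subseteq> \<phi> ` G" using W(3) by blast
      ultimately show ?thesis by blast
    qed
    then show "openin (subtopology T' (\<phi> ` topspace T)) (\<phi> ` G)" by (subst openin_subopen) blast
  qed
qed (rule inj)

text \<open>
  A continuous image in a Hausdorff space is closed if every filter on the domain whose image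
  converges has a cluster point.
\<close>

lemma closedin_image_if_cluster_points:
  assumes cont: "continuous_map T T' \<phi>" and haus: "Hausdorff_space T'"
    and cluster: "\<And>F y. F \<noteq> bot \<Longrightarrow> F \<le> principal (topspace T) \<Longrightarrow> y \<in> topspace T' \<Longrightarrow>
      (\<And>G. openin T' G \<Longrightarrow> y \<in> G \<Longrightarrow> \<forall>\<^sub>F x in F. \<phi> x \<in> G) \<Longrightarrow> \<exists>x. cluster_point T F x"
  shows "closedin T' (\<phi> ` topspace T)"
proof -
  have sub: "\<phi> ` topspace T \<subseteq> topspace T'" using cont continuous_map_image_subset_topspace by blast
  have "y \<in> \<phi> ` topspace T" if y: "y \<in> T' closure_of (\<phi> ` topspace T)" for y
  proof -
    have yT: "y \<in> topspace T'"
      and meets: "\<And>G. openin T' G \<Longrightarrow> y \<in> G \<Longrightarrow> \<exists>x\<in>topspace T. \<phi> x \<in> G"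
      using y by (auto simp: in_closure_of)
    define F where "F = inf (filtercomap \<phi> (nhdsin T' y)) (principal (topspace T))"
    have ev: "eventually P F \<longleftrightarrow>
        (\<exists>G. openin T' G \<and> y \<in> G \<and> (\<forall>x\<in>topspace T. \<phi> x \<in> G \<longrightarrow> P x))" for P
    proof
      assume "eventually P F"
      then obtain Q where "eventually Q (nhdsin T' y)" "\<And>x. Q (\<phi> x) \<Longrightarrow> x \<in> topspace T \<longrightarrow> P x"
        unfolding F_def eventually_inf_principal eventually_filtercomap by blast
      then show "\<exists>G. openin T' G \<and> y \<in> G \<and> (\<forall>x\<in>topspace T. \<phi> x \<in> G \<longrightarrow> P x)"
        using yT unfolding eventually_nhdsin by blast
    next
      assume "\<exists>G. openin T' G \<and> y \<in> G \<and> (\<forall>x\<in>topspace T. \<phi> x \<in> G \<longrightarrow> P x)"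
      then obtain G where "openin T' G" "y \<in> G" "\<forall>x\<in>topspace T. \<phi> x \<in> G \<longrightarrow> P x" by blast
      then show "eventually P F"
        unfolding F_def eventually_inf_principal eventually_filtercomap eventually_nhdsin
        by (intro exI[of _ "\<lambda>z. z \<in> G"]) auto
    qed
    have "F \<noteq> bot" using ev[of "\<lambda>_. False"] meets by (auto simp: trivial_limit_def)
    moreover have "F \<le> principal (topspace T)" unfolding F_def by simp
    moreover have "\<forall>\<^sub>F x in F. \<phi> x \<in> G" if "openin T' G" "y \<in> G" for G
      unfolding ev using that by blast
    ultimately obtain x where x: "cluster_point T F x" using cluster[of F y] yT by blast
    have xT: "x \<in> topspace T" using x unfolding cluster_point_def by blast
    have "\<phi> x = y"
    proof (rule ccontr)
      assume "\<phi> x \<noteq> y"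
      then obtain G H where GH: "openin T' G" "openin T' H" "\<phi> x \<in> G" "y \<in> H" "disjnt G H"
        using haus xT yT sub unfolding Hausdorff_space_def by (metis image_subset_iff)
      have "openin T {z \<in> topspace T. \<phi> z \<in> G}"
        using cont GH(1) by (rule openin_continuous_map_preimage)
      then have "\<exists>\<^sub>F z in F. z \<in> {z \<in> topspace T. \<phi> z \<in> G}"
        using x xT GH(3) unfolding cluster_point_def by blast
      moreover have "\<forall>\<^sub>F z in F. z \<notin> {z \<in> topspace T. \<phi> z \<in> G}"
        using GH(2,4,5) unfolding ev disjnt_def by blast
      ultimately show False unfolding frequently_def by blast
    qed
    then show ?thesis using xT by blast
  qed
  then show ?thesis using sub closure_of_subset_eq by blast
qed


section \<open>Coordinates of the target space\<close>

lemma cover_uniformity_discrete: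
  "cover_uniformity D (metric_uniformity (discrete_metric_on D))"
  using cover_uniformity_metric[of "discrete_metric_on D"] by simp

lemma cover_uniformity_discrete_family:
  "cover_uniformity (case j of (i, n) \<Rightarrow> Field (\<kappa> i n))
      (case j of (i, n) \<Rightarrow> metric_uniformity (discrete_metric_on (Field (\<kappa> i n))))"
  by (simp add: cover_uniformity_discrete case_prod_beta)

lemma cover_uniformity_real: "cover_uniformity UNIV real_uniformity"
  using cover_uniformity_metric[of euclidean_metric] by simp

lemma unif_continuous_target_discrete:
  assumes "i \<in> I" and "n \<ge> 1"
  shows "unif_continuous (target_space I \<kappa> \<alpha>) (target_uniformity I \<kappa> \<alpha>) (Field (\<kappa> i n))
    (metric_uniformity (discrete_metric_on (Field (\<kappa> i n)))) (\<lambda>p. fst p (i, n))"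
proof -
  let ?Y = "\<lambda>(i, n). Field (\<kappa> i n)"
  let ?\<nu> = "\<lambda>(i, n). metric_uniformity (discrete_metric_on (Field (\<kappa> i n)))"
  have "unif_continuous (PiE (I \<times> {1..}) ?Y) (prod_uniformity (I \<times> {1..}) ?Y ?\<nu>)
      (?Y (i, n)) (?\<nu> (i, n)) (\<lambda>f. f (i, n))"
    by (rule unif_continuous_proj[OF cover_uniformity_discrete_family]) (use assms in simp)
  then show ?thesis
    unfolding target_space_def target_uniformity_def
    by (intro unif_continuous_compose[OF unif_continuous_fst])
      (auto intro!: cover_uniformity_prod cover_uniformity_discrete cover_uniformity_real)
qed

lemma unif_continuous_target_real:
  assumes "a \<in> Field \<alpha>"
  shows "unif_continuous (target_space I \<kappa> \<alpha>) (target_uniformity I \<kappa> \<alpha>) UNIV real_uniformity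
    (\<lambda>p. snd p a)"
proof -
  have "unif_continuous (\<Pi>\<^sub>E a \<in> Field \<alpha>. UNIV)
      (prod_uniformity (Field \<alpha>) (\<lambda>a. UNIV) (\<lambda>a. real_uniformity)) UNIV real_uniformity (\<lambda>f. f a)"
    using assms
    by (rule unif_continuous_proj[where Y = "\<lambda>_. UNIV" and \<nu> = "\<lambda>_. real_uniformity",
          OF cover_uniformity_real])
  then show ?thesis
    unfolding target_space_def target_uniformity_def
    by (intro unif_continuous_compose[OF unif_continuous_snd])
      (auto intro!: cover_uniformity_prod cover_uniformity_discrete cover_uniformity_real)
qed

lemma Hausdorff_space_target:
  "Hausdorff_space (unif_topology (target_space I \<kappa> \<alpha>) (target_uniformity I \<kappa> \<alpha>))"
  unfolding Hausdorff_space_def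
proof (intro allI impI)
  note tgt = cover_uniformity_target[of I \<kappa> \<alpha>]
  let ?T = "unif_topology (target_space I \<kappa> \<alpha>) (target_uniformity I \<kappa> \<alpha>)"
  fix p q assume pq: "p \<in> topspace ?T \<and> q \<in> topspace ?T \<and> p \<noteq> q"
  then have Y: "p \<in> target_space I \<kappa> \<alpha>" "q \<in> target_space I \<kappa> \<alpha>" using tgt by auto
  consider "fst p \<noteq> fst q" | "snd p \<noteq> snd q" using pq by (auto simp: prod_eq_iff)
  then show "\<exists>U V. openin ?T U \<and> openin ?T V \<and> p \<in> U \<and> q \<in> V \<and> disjnt U V"
  proof cases
    case 1
    have fst: "fst p \<in> PiE (I \<times> {1..}) (\<lambda>(i, n). Field (\<kappa> i n))"
      "fst q \<in> PiE (I \<times> {1..}) (\<lambda>(i, n). Field (\<kappa> i n))"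
      using Y by (simp_all add: target_space_def mem_Times_iff)
    have "\<exists>j\<in>I \<times> {1..}. fst p j \<noteq> fst q j"
      using 1 PiE_ext[OF fst] by blast
    then obtain i n where j: "i \<in> I" "n \<ge> 1" "fst p (i, n) \<noteq> fst q (i, n)" by auto
    then show ?thesis
      by (intro separated_by_metric_map[OF tgt, of "discrete_metric_on (Field (\<kappa> i n))"
            "\<lambda>p. fst p (i, n)"]) (use unif_continuous_target_discrete[OF j(1,2)] Y in simp_all)
  next
    case 2
    have snd: "snd p \<in> PiE (Field \<alpha>) (\<lambda>_. UNIV)" "snd q \<in> PiE (Field \<alpha>) (\<lambda>_. UNIV)"
      using Y by (simp_all add: target_space_def mem_Times_iff)
    obtain a where a: "a \<in> Field \<alpha>" "snd p a \<noteq> snd q a" using 2 PiE_ext[OF snd] by blast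
    then show ?thesis
      by (intro separated_by_metric_map[OF tgt, of euclidean_metric "\<lambda>p. snd p a"])
        (use unif_continuous_target_real[OF a(1)] Y in simp_all)
  qed
qed


section \<open>Suprema of cardinals on different types\<close>

lemma card_sup_ordLeq:
  fixes R :: "'b rel set" and R' :: "'c rel set"
  assumes R: "\<And>r. r \<in> R \<Longrightarrow> Card_order r" and R': "\<And>r. r \<in> R' \<Longrightarrow> Card_order r"
    and le: "\<And>r. r \<in> R \<Longrightarrow> \<exists>r'\<in>R'. r \<le>o r'"
  shows "card_sup R \<le>o card_sup R'"
proof -
  have s: "is_card_sup R (card_sup R)" by (rule is_card_sup_card_sup) (rule R)
  have s': "is_card_sup R' (card_sup R')" by (rule is_card_sup_card_sup) (rule R')
  have ub: "r \<le>o card_sup R'" if "r \<in> R" for r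
    using le[OF that] s' ordLeq_transitive unfolding is_card_sup_def by blast
  have co: "Card_order (card_sup R)" "Card_order (card_sup R')"
    using s s' unfolding is_card_sup_def by blast+
  show ?thesis
  proof (rule ccontr)
    assume "\<not> card_sup R \<le>o card_sup R'"
    then have less: "card_sup R' <o card_sup R"
      using co by (metis card_order_on_well_order_on not_ordLeq_iff_ordLess)
    \<comment> \<open>The smaller of the two suprema has a copy on the type of the larger one.\<close>
    obtain t :: "'b rel" where t: "(card_sup R', t) \<in> ordIso" "t \<le>o card_sup R"
      using iffD1[OF internalize_ordLeq, OF ordLess_imp_ordLeq[OF less]] by blast
    have "Card_order t" using t(1) co(2) Card_order_ordIso2 by blast
    moreover have "r \<le>o t" if "r \<in> R" for r using ub[OF that] t(1) ordLeq_ordIso_trans by blast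
    ultimately have "card_sup R \<le>o t" using s unfolding is_card_sup_def by blast
    then have "card_sup R \<le>o card_sup R'" using t(1) ordIso_symmetric ordLeq_ordIso_trans by blast
    then show False using less not_ordLess_ordLeq by blast
  qed
qed

section \<open>The embedding\<close>

text \<open>The member of the partition \<open>P\<close> that contains \<open>x\<close>.\<close>

definition cell :: "'a set set \<Rightarrow> 'a \<Rightarrow> 'a set" where
  "cell P x = (THE C. C \<in> P \<and> x \<in> C)"

lemma cell_eq:
  assumes "partition_on X P" and "C \<in> P" and "x \<in> C"
  shows "cell P x = C"
  unfolding cell_def
proof (rule the_equality)
  show "D = C" if "D \<in> P \<and> x \<in> D" for D
    using that assms partition_onD2[OF assms(1)] unfolding disjoint_def by blast
qed (use assms in blast)

lemma cell_mem:
  assumes "partition_on X P" and "x \<in> X"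
  shows "cell P x \<in> P" and "x \<in> cell P x"
proof -
  obtain C where "C \<in> P" "x \<in> C" using assms partition_onD1 by fast
  then show "cell P x \<in> P" "x \<in> cell P x" using cell_eq[OF assms(1)] by simp_all
qed

text \<open>
  The uniformly continuous real functions on \<open>X\<close>. Their values outside \<open>X\<close> are arbitrary, so
  functions that agree on \<open>X\<close> may occur as different members; this only repeats coordinates.
\<close>

definition uniform_functions :: "'a set \<Rightarrow> 'a set set set \<Rightarrow> ('a \<Rightarrow> real) set" where
  "uniform_functions X \<mu> = {f. unif_continuous X \<mu> UNIV real_uniformity f}"

text \<open>
  The embedding. Its discrete coordinates, indexed by the uniform partitions \<open>P\<close> and by \<open>n \<ge> 1\<close>,
  send a point to its cell in \<open>P\<close>, whatever \<open>n\<close> is; its real coordinates evaluate all uniformly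
  continuous functions.
\<close>

definition coordinate_map ::
  "'a set \<Rightarrow> 'a set set set \<Rightarrow> 'a \<Rightarrow> ('a set set \<times> nat \<Rightarrow> 'a set) \<times> (('a \<Rightarrow> real) \<Rightarrow> real)" where
  "coordinate_map X \<mu> x =
     ((\<lambda>(P, n) \<in> {P. uniform_partition X \<mu> P} \<times> {1..}. cell P x),
      (\<lambda>f \<in> uniform_functions X \<mu>. f x))"

text \<open>
  The parameters of the target space: \<open>\<kappa> P n = |P|\<close> for each uniform partition \<open>P\<close> and each \<open>n\<close>,
  and \<open>\<alpha>\<close> is the number of uniformly continuous real functions.
\<close>

context
  fixes X :: "'a set" and \<mu> :: "'a set set set"
  assumes \<mu>: "cover_uniformity X \<mu>"
begin

private abbreviation (input) "I \<equiv> {P. uniform_partition X \<mu> P}"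
private abbreviation (input) "\<kappa> \<equiv> \<lambda>P (n::nat). card_of (P :: 'a set set)"
private abbreviation (input) "\<alpha> \<equiv> card_of (uniform_functions X \<mu>)"
private abbreviation (input) "T \<equiv> unif_topology X \<mu>"
private abbreviation (input) "T' \<equiv> unif_topology (target_space I \<kappa> \<alpha>) (target_uniformity I \<kappa> \<alpha>)"

lemma natLeq_uniform_functions: "natLeq \<le>o \<alpha>"
proof -
  have "(\<lambda>_. c) \<in> uniform_functions X \<mu>" for c
  proof -
    have "unif_continuous X \<mu> UNIV real_uniformity (\<lambda>_. c)"
      by (rule unif_continuous_realI[OF \<mu>]) (use uniformity_nonempty[OF \<mu>] in auto)
    then show ?thesis by (simp add: uniform_functions_def)
  qed
  then have "range (\<lambda>c. \<lambda>_. c) \<subseteq> uniform_functions X \<mu>" by blast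
  moreover have "inj (\<lambda>c :: real. \<lambda>_ :: 'a. c)" by (auto simp: inj_def fun_eq_iff)
  then have "infinite (range (\<lambda>c :: real. \<lambda>_ :: 'a. c))"
    using finite_imageD infinite_UNIV_char_0 by blast
  ultimately have "infinite (uniform_functions X \<mu>)" using finite_subset by blast
  then show ?thesis using infinite_iff_natLeq_ordLeq by blast
qed

lemma unif_continuous_coordinate_map:
  "unif_continuous X \<mu> (target_space I \<kappa> \<alpha>) (target_uniformity I \<kappa> \<alpha>) (coordinate_map X \<mu>)"
proof -
  have "unif_continuous X \<mu> (\<Pi>\<^sub>E (i, n) \<in> I \<times> {1..}. Field (\<kappa> i n))
      (prod_uniformity (I \<times> {1..}) (\<lambda>(i, n). Field (\<kappa> i n))
        (\<lambda>(i, n). metric_uniformity (discrete_metric_on (Field (\<kappa> i n)))))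
      (\<lambda>x. \<lambda>(P, n) \<in> I \<times> {1..}. cell P x)"
  proof (rule unif_continuous_prod[OF \<mu>])
    show "(\<lambda>(P, n) \<in> I \<times> {1..}. cell P x) \<in> (\<Pi>\<^sub>E (i, n) \<in> I \<times> {1..}. Field (\<kappa> i n))"
      if "x \<in> X" for x
      using that cell_mem(1) by (auto simp: uniform_partition_def Field_card_of)
    fix j assume "j \<in> I \<times> {1::nat..}"
    then obtain P n where j: "j = (P, n)" "P \<in> I" "n \<ge> 1" by auto
    then have P: "partition_on X P" "P \<in> \<mu>" by (auto simp: uniform_partition_def)
    have "unif_continuous X \<mu> P (metric_uniformity (discrete_metric_on P)) (cell P)"
    proof (rule unif_continuous_discrete[OF \<mu> P(2)])
      show "\<exists>C\<in>P. \<forall>x\<in>A. cell P x = C" if "A \<in> P" for A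
        using that cell_eq[OF P(1) that] by (intro bexI[of _ A]) auto
    qed
    then show "unif_continuous X \<mu> (case j of (i, n) \<Rightarrow> Field (\<kappa> i n))
        (case j of (i, n) \<Rightarrow> metric_uniformity (discrete_metric_on (Field (\<kappa> i n))))
        (\<lambda>x. (\<lambda>(P, n) \<in> I \<times> {1..}. cell P x) j)"
      using j by (simp add: Field_card_of)
  qed
  moreover have "unif_continuous X \<mu> (\<Pi>\<^sub>E a \<in> Field \<alpha>. UNIV)
      (prod_uniformity (Field \<alpha>) (\<lambda>a. UNIV) (\<lambda>a. real_uniformity))
      (\<lambda>x. \<lambda>f \<in> uniform_functions X \<mu>. f x)"
  proof (rule unif_continuous_prod[OF \<mu>])
    show "unif_continuous X \<mu> UNIV real_uniformity (\<lambda>x. (\<lambda>f \<in> uniform_functions X \<mu>. f x) f)"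
      if "f \<in> Field \<alpha>" for f
      using that by (simp add: Field_card_of uniform_functions_def)
  qed (simp add: Field_card_of)
  ultimately show ?thesis
    unfolding target_space_def target_uniformity_def coordinate_map_def
    by (rule unif_continuous_pair[OF \<mu>])
qed

lemma continuous_coordinate_map: "continuous_map T T' (coordinate_map X \<mu>)"
  by (rule unif_continuous_imp_continuous_map[OF \<mu> cover_uniformity_target
        unif_continuous_coordinate_map])

lemma snd_coordinate_map:
  "f \<in> uniform_functions X \<mu> \<Longrightarrow> snd (coordinate_map X \<mu> x) f = f x"
  unfolding coordinate_map_def by simp

lemma fst_coordinate_map:
  "uniform_partition X \<mu> P \<Longrightarrow> fst (coordinate_map X \<mu> x) (P, 1) = cell P x"
  unfolding coordinate_map_def by simp

text \<open>Every neighbourhood is witnessed by the distance to its centre in a pseudometric.\<close>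

lemma uniform_function_separates:
  assumes "openin T G" and "x \<in> G"
  obtains f where "f \<in> uniform_functions X \<mu>" "f x = 0" "\<And>y. y \<in> X \<Longrightarrow> f y < 1 \<Longrightarrow> y \<in> G"
proof -
  obtain U where U: "U \<in> \<mu>" "star {x} U \<subseteq> G" and GX: "G \<subseteq> X"
    using openin_unif_topology[OF \<mu>, THEN iffD1, OF assms(1)] assms(2) by blast
  obtain d where d: "pseudometric d"
    and dU: "\<And>x y. x \<in> X \<Longrightarrow> y \<in> X \<Longrightarrow> d x y < 1 \<Longrightarrow> (x, y) \<in> entourage U"
    and du: "\<And>e. e > 0 \<Longrightarrow> \<exists>V\<in>\<mu>. \<forall>A\<in>V. \<forall>x\<in>A. \<forall>y\<in>A. d x y < e"
    using uniform_pseudometric[OF \<mu> U(1)] by metis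
  show thesis
  proof
    show "d x \<in> uniform_functions X \<mu>"
      using unif_continuous_pseudometric[OF \<mu> d du] by (simp add: uniform_functions_def)
    show "d x x = 0" by (rule pseudometric_refl[OF d])
    show "y \<in> G" if "y \<in> X" "d x y < 1" for y
    proof -
      have "x \<in> X" using GX assms(2) by blast
      then have "(x, y) \<in> entourage U" using dU that by blast
      then have "y \<in> star {x} U" unfolding entourage_def star_def by blast
      then show ?thesis using U(2) by blast
    qed
  qed
qed

lemma embedding_coordinate_map:
  assumes haus: "Hausdorff_space T"
  shows "embedding_map T T' (coordinate_map X \<mu>)"
proof (rule embedding_map_if_separates[OF continuous_coordinate_map])
  let ?\<phi> = "coordinate_map X \<mu>"
  have topT: "topspace T = X" using \<mu> by simp
  show "inj_on ?\<phi> (topspace T)"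
  proof (rule inj_onI, rule ccontr)
    fix x y assume xy: "x \<in> topspace T" "y \<in> topspace T" "?\<phi> x = ?\<phi> y" "x \<noteq> y"
    then obtain G H where "openin T G" "openin T H" "x \<in> G" "y \<in> H" "disjnt G H"
      using haus unfolding Hausdorff_space_def by metis
    then have G: "openin T G" "x \<in> G" "y \<notin> G" by (auto simp: disjnt_def)
    obtain f where f: "f \<in> uniform_functions X \<mu>" "f x = 0"
      "\<And>y. y \<in> X \<Longrightarrow> f y < 1 \<Longrightarrow> y \<in> G"
      using uniform_function_separates[OF G(1,2)] by metis
    have "f y = f x" using snd_coordinate_map[OF f(1)] xy(3) by metis
    then show False using f(2) f(3)[of y] G(3) xy(2) topT by simp
  qed
  fix G x assume G: "openin T G" "x \<in> G"
  then have xX: "x \<in> X" using openin_subset topT by blast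
  obtain f where f: "f \<in> uniform_functions X \<mu>" "f x = 0" "\<And>y. y \<in> X \<Longrightarrow> f y < 1 \<Longrightarrow> y \<in> G"
    using uniform_function_separates[OF G] by metis
  define W where "W = {p \<in> target_space I \<kappa> \<alpha>. snd p f \<in> mball_of euclidean_metric 0 1}"
  have "unif_continuous (target_space I \<kappa> \<alpha>) (target_uniformity I \<kappa> \<alpha>)
      (mspace euclidean_metric) real_uniformity (\<lambda>p. snd p f)"
    using unif_continuous_target_real[of f \<alpha> I \<kappa>] f(1) by (simp add: Field_card_of)
  then have "openin T' W"
    unfolding W_def by (rule openin_preimage_mball[OF cover_uniformity_target])
  moreover have "?\<phi> x \<in> W"
    using unif_continuous_coordinate_map xX f(2)
    by (auto simp: W_def unif_continuous_def snd_coordinate_map[OF f(1)])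
  moreover have "\<forall>z\<in>topspace T. ?\<phi> z \<in> W \<longrightarrow> z \<in> G"
    using f(3) topT by (auto simp: W_def snd_coordinate_map[OF f(1)] dist_real_def)
  ultimately show "\<exists>W. openin T' W \<and> ?\<phi> x \<in> W \<and> (\<forall>z\<in>topspace T. ?\<phi> z \<in> W \<longrightarrow> z \<in> G)"
    by blast
qed

text \<open>
  If the image of a filter converges in the target space, then for each uniform cover \<open>U\<close> the
  filter lives on one chain component of \<open>U\<close>, by a discrete coordinate, and the coarse distance
  function of \<open>U\<close> is bounded along it, by a real coordinate.
\<close>

lemma Bourbaki_Cauchy_if_coordinates_converge:
  assumes F: "F \<noteq> bot" "F \<le> principal X" and y: "y \<in> target_space I \<kappa> \<alpha>"
    and conv: "\<And>G. openin T' G \<Longrightarrow> y \<in> G \<Longrightarrow> \<forall>\<^sub>F x in F. coordinate_map X \<mu> x \<in> G"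
  shows "Bourbaki_Cauchy \<mu> F"
  unfolding Bourbaki_Cauchy_def
proof
  fix U assume U: "U \<in> \<mu>"
  let ?P = "chain_component U ` X"
  note tgt = cover_uniformity_target[of I \<kappa> \<alpha>]
  have FX: "\<forall>\<^sub>F x in F. x \<in> X" using F(2) by (simp add: le_principal)
  then have "X \<noteq> {}" using F(1) by (auto simp: trivial_limit_def)
  then have P: "uniform_partition X \<mu> ?P" by (rule uniform_partition_chain_components[OF \<mu> U])
  obtain \<rho> where \<rho>: "unif_continuous X \<mu> UNIV real_uniformity \<rho>"
    and bdd: "\<And>C M. C \<in> ?P \<Longrightarrow> \<exists>m. \<exists>A\<in>U. \<forall>x\<in>C. \<rho> x < M \<longrightarrow> x \<in> star_iter m A U"
    using coarse_distance[OF \<mu> U] by metis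
  define C where "C = fst y (?P, 1)"
  have CP: "C \<in> ?P"
    using y P unfolding target_space_def C_def mem_Times_iff
    by (auto simp: Field_card_of dest!: PiE_mem[of _ _ _ "(?P, 1)"])
  have "\<forall>\<^sub>F x in F. coordinate_map X \<mu> x \<in>
      {p \<in> target_space I \<kappa> \<alpha>. fst p (?P, 1) \<in> mball_of (discrete_metric_on ?P) C 1}"
  proof (rule conv)
    have "unif_continuous (target_space I \<kappa> \<alpha>) (target_uniformity I \<kappa> \<alpha>)
        (mspace (discrete_metric_on ?P)) (metric_uniformity (discrete_metric_on ?P))
        (\<lambda>p. fst p (?P, 1))"
      using unif_continuous_target_discrete[of ?P I 1 \<kappa> \<alpha>] P by (simp add: Field_card_of)
    then show "openin T'
        {p \<in> target_space I \<kappa> \<alpha>. fst p (?P, 1) \<in> mball_of (discrete_metric_on ?P) C 1}"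
      by (rule openin_preimage_mball[OF tgt])
    show "y \<in> {p \<in> target_space I \<kappa> \<alpha>. fst p (?P, 1) \<in> mball_of (discrete_metric_on ?P) C 1}"
      using y CP by (simp add: C_def)
  qed
  then have inC: "\<forall>\<^sub>F x in F. x \<in> C"
    using FX
  proof eventually_elim
    case (elim x)
    have "cell ?P x = C"
      using elim(1) fst_coordinate_map[OF P, of x] by (auto split: if_splits)
    then show ?case using cell_mem(2)[of X ?P x] P elim(2) by (simp add: uniform_partition_def)
  qed
  have \<rho>_mem: "\<rho> \<in> uniform_functions X \<mu>" using \<rho> by (simp add: uniform_functions_def)
  have "\<forall>\<^sub>F x in F. coordinate_map X \<mu> x \<in>
      {p \<in> target_space I \<kappa> \<alpha>. snd p \<rho> \<in> mball_of euclidean_metric (snd y \<rho>) 1}"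
  proof (rule conv)
    have "unif_continuous (target_space I \<kappa> \<alpha>) (target_uniformity I \<kappa> \<alpha>)
        (mspace euclidean_metric) real_uniformity (\<lambda>p. snd p \<rho>)"
      using unif_continuous_target_real[of \<rho> \<alpha> I \<kappa>] \<rho>_mem by (simp add: Field_card_of)
    then show "openin T'
        {p \<in> target_space I \<kappa> \<alpha>. snd p \<rho> \<in> mball_of euclidean_metric (snd y \<rho>) 1}"
      by (rule openin_preimage_mball[OF tgt])
  qed (use y in simp)
  then have "\<forall>\<^sub>F x in F. \<rho> x < snd y \<rho> + 1"
    by (rule eventually_mono) (auto simp: snd_coordinate_map[OF \<rho>_mem] dist_real_def)
  moreover obtain m A where "A \<in> U" "\<forall>x\<in>C. \<rho> x < snd y \<rho> + 1 \<longrightarrow> x \<in> star_iter m A U"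
    using bdd[OF CP] by metis
  ultimately have "\<forall>\<^sub>F x in F. x \<in> star_iter m A U"
    using inC by (auto elim: eventually_elim2)
  then show "\<exists>m. \<exists>A\<in>U. \<forall>\<^sub>F x in F. x \<in> star_iter m A U" using \<open>A \<in> U\<close> by blast
qed

lemma closedin_coordinate_map:
  assumes "Bourbaki_complete X \<mu>"
  shows "closedin T' (coordinate_map X \<mu> ` X)"
proof -
  have "closedin T' (coordinate_map X \<mu> ` topspace T)"
  proof (rule closedin_image_if_cluster_points[OF continuous_coordinate_map
        Hausdorff_space_target])
    fix F y assume F: "F \<noteq> bot" "F \<le> principal (topspace T)" and y: "y \<in> topspace T'"
      and conv: "\<And>G. openin T' G \<Longrightarrow> y \<in> G \<Longrightarrow> \<forall>\<^sub>F x in F. coordinate_map X \<mu> x \<in> G"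
    have "F \<le> principal X" using F(2) \<mu> by simp
    moreover have "y \<in> target_space I \<kappa> \<alpha>"
      using y topspace_unif_topology[OF cover_uniformity_target] by blast
    ultimately have "Bourbaki_Cauchy \<mu> F"
      using Bourbaki_Cauchy_if_coordinates_converge[OF F(1)] conv by blast
    then show "\<exists>x. cluster_point T F x"
      using assms F(1) \<open>F \<le> principal X\<close> unfolding Bourbaki_complete_def by blast
  qed
  then show ?thesis using \<mu> by simp
qed

lemma partition_number_ordLeq:
  "partition_number X \<mu> \<le>o card_sup {|\<Pi>\<^sub>E j\<in>{1..n}. Field (\<kappa> i j)| | n i. n \<ge> 1 \<and> i \<in> I}"
  unfolding partition_number_def
proof (rule card_sup_ordLeq)
  fix r assume "r \<in> {|P| | P. uniform_partition X \<mu> P}"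
  then obtain P where P: "r = |P|" "P \<in> I" by blast
  \<comment> \<open>The product with the single factor \<open>P\<close> already bounds \<open>|P|\<close>.\<close>
  have "inj_on (\<lambda>C. \<lambda>j\<in>{1..1::nat}. C) P"
    by (rule inj_onI) (metis atLeastAtMost_iff order_refl restrict_apply')
  moreover have "(\<lambda>C. \<lambda>j\<in>{1..1::nat}. C) ` P \<subseteq> (\<Pi>\<^sub>E j\<in>{1..1}. Field (\<kappa> P j))"
    by (auto simp: Field_card_of)
  ultimately have "|P| \<le>o |\<Pi>\<^sub>E j\<in>{1..1}. Field (\<kappa> P j)|" by (intro iffD1[OF card_of_ordLeq] exI conjI)
  moreover have "|\<Pi>\<^sub>E j\<in>{1..1}. Field (\<kappa> P j)| \<in>
      {|\<Pi>\<^sub>E j\<in>{1..n}. Field (\<kappa> i j)| | n i. n \<ge> 1 \<and> i \<in> I}" using P(2) by blast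
  ultimately show "\<exists>r'\<in>{|\<Pi>\<^sub>E j\<in>{1..n}. Field (\<kappa> i j)| | n i. n \<ge> 1 \<and> i \<in> I}. r \<le>o r'"
    unfolding P(1) by blast
qed (auto simp: card_of_Card_order)

end

theorem theorem2p1p5:
  fixes X :: "'a set" and \<mu> :: "'a set set set"
  assumes "cover_uniformity X \<mu>"
    and "Hausdorff_space (unif_topology X \<mu>)"
    and "Bourbaki_complete X \<mu>"
  shows "\<exists>(I :: 'a set set set) (\<kappa> :: 'a set set \<Rightarrow> nat \<Rightarrow> 'a set rel) (\<alpha> :: ('a \<Rightarrow> real) rel)
            (\<phi> :: 'a \<Rightarrow> ('a set set \<times> nat \<Rightarrow> 'a set) \<times> (('a \<Rightarrow> real) \<Rightarrow> real)).
      (\<forall>i\<in>I. \<forall>n\<ge>1. Card_order (\<kappa> i n)) \<and>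
      Card_order \<alpha> \<and> natLeq \<le>o \<alpha> \<and>
      embedding_map (unif_topology X \<mu>)
        (unif_topology (target_space I \<kappa> \<alpha>) (target_uniformity I \<kappa> \<alpha>)) \<phi> \<and>
      unif_continuous X \<mu> (target_space I \<kappa> \<alpha>) (target_uniformity I \<kappa> \<alpha>) \<phi> \<and>
      closedin (unif_topology (target_space I \<kappa> \<alpha>) (target_uniformity I \<kappa> \<alpha>)) (\<phi> ` X) \<and>
      partition_number X \<mu> \<le>o
        card_sup {|\<Pi>\<^sub>E j\<in>{1..n}. Field (\<kappa> i j)| | n i. n \<ge> 1 \<and> i \<in> I}"
proof (intro exI conjI)
  show "\<forall>i\<in>{P. uniform_partition X \<mu> P}. \<forall>n\<ge>1. Card_order ((\<lambda>P (n::nat). card_of P) i n)"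
    by (simp add: card_of_Card_order)
  show "Card_order (card_of (uniform_functions X \<mu>))" by (rule card_of_Card_order)
qed (fact natLeq_uniform_functions[OF assms(1)] embedding_coordinate_map[OF assms(1,2)]
      unif_continuous_coordinate_map[OF assms(1)] closedin_coordinate_map[OF assms(1,3)]
      partition_number_ordLeq[OF assms(1)])+

end
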